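(* Let $S_1=0$, $S_2=\tfrac12$, $S_3=1$, and let $f:\mathbb{R}\to\mathbb{R}$ be a $C^1$ function such that $f(u)\ge 0$ for all $u\in[0,1]$ and whose zeros in $[0,1]$ are exactly the three points $S_1,S_2,S_3$. Let $c_{12}^*$ and $c_{23}^*$ denote the critical speeds of $f$ on the intervals $[S_1,S_2]$ and $[S_2,S_3]$ respectively (defined in the context), and assume that $c_{12}^*>c_{23}^*$. Let $u(x,t)$ be the solution, for $x\in\mathbb{R}$, $t\ge0$, of $$\partial_t u=\partial_x^2u+f(u)$$ with an initial condition $u(\cdot,0)$ taking values in $[S_1,S_3]$ and reaching the limits $S_1$ at $+\infty$ and $S_3$ at $-\infty$ for finite $x$, i.e., there are real numbers $a<b$ with $u(x,0)=S_3$ for all $x\le a$ and $u(x,0)=S_1$ for all $x\ge b$. Then for every $x\in\mathbb{R}$ and every $c\in\mathbb{R}$ with $c\neq c_{12}^*$, $c\ne c_{23}^*$, $$\lim_{t\to\infty}u(x+ct,t)=\begin{cases}S_3, & \text{if } c<c_{23}^*,\\ S_2, & \text{if } c_{23}^*<c<c_{12}^*,\\ S_1, & \text{if } c>c_{12}^*.\end{cases}$$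
   Context: Solution: $u$ is a bounded continuous function on $\mathbb{R}\times[0,\infty)$, continuously differentiable once in $t$ and twice in $x$ for $t>0$, satisfying the equation for $t>0$ and having the prescribed values at $t=0$. Critical speed. Let $\ell<r$ and let $f$ be $C^1$ with $f(\ell)=f(r)=0$ and $f>0$ on $(\ell,r)$. For $c>0$ and $\varepsilon>0$, let $p_{c,\varepsilon}(q)$ be the solution of $$\frac{dp}{dq}=-c-\frac{f(q)}{p}$$ in the strip $(q,p)\in[\ell,r]\times(-\infty,0]$ with initial condition $p_{c,\varepsilon}(\ell)=-\varepsilon$; if the solution reaches $p_{c,\varepsilon}(\tilde q)=0$ for some $\tilde q>\ell$, then one sets $p_{c,\varepsilon}(q)=0$ for all $q\in(\tilde q,r]$. For fixed $q$, $p_{c,\varepsilon}(q)$ is non-increasing in $\varepsilon$ and bounded above by $0$, so $p_c(q)=\lim_{\varepsilon\downarrow0}p_{c,\varepsilon}(q)$ exists. The critical speed of $f$ on $[\ell,r]$ is $$c_{\ell r}^*=\inf\{c>0 \mid p_c(r)<0\}.$$ The speed $c_{12}^*$ is obtained with $(\ell,r)=(S_1,S_2)$, and $c_{23}^*$ with $(\ell,r)=(S_2,S_3)$. *)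

theory Defs
  imports "HOL-Analysis.Analysis"
begin

text \<open>
  The trajectory starting from \<open>- e\<close> at \<open>q = l\<close>, in the strip \<open>{l..r} \<times> {..0}\<close>.
  The equation is imposed only while \<open>p q < 0\<close>; the last clause says that a trajectory
  reaching \<open>0\<close> stays there, and continuity on \<open>{l..r}\<close> fixes the value at the point where \<open>0\<close>
  is reached (which may be \<open>r\<close>). At the endpoints the derivative is one-sided.
\<close>

definition trajectory ::
    "(real \<Rightarrow> real) \<Rightarrow> real \<Rightarrow> real \<Rightarrow> real \<Rightarrow> real \<Rightarrow> (real \<Rightarrow> real) \<Rightarrow> bool" where
  "trajectory f l r c e p \<longleftrightarrow>
     continuous_on {l..r} p \<and>
     p l = - e \<and>
     (\<forall>q\<in>{l..r}. p q \<le> 0) \<and>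
     (\<forall>q\<in>{l..r}. p q < 0 \<longrightarrow>
        (p has_real_derivative (- c - f q / p q)) (at q within {l..r})) \<and>
     (\<forall>q\<in>{l..r}. p q = 0 \<longrightarrow> (\<forall>q'\<in>{q..r}. p q' = 0))"

text \<open>
  The description is taken of the value at \<open>q\<close>, because a trajectory is
  determined only on \<open>{l..r}\<close>.
\<close>

definition p_eps ::
    "(real \<Rightarrow> real) \<Rightarrow> real \<Rightarrow> real \<Rightarrow> real \<Rightarrow> real \<Rightarrow> real \<Rightarrow> real" where
  "p_eps f l r c e q = (THE y. \<exists>p. trajectory f l r c e p \<and> p q = y)"

definition p_lim ::
    "(real \<Rightarrow> real) \<Rightarrow> real \<Rightarrow> real \<Rightarrow> real \<Rightarrow> real \<Rightarrow> real" where
  "p_lim f l r c q = Lim (at_right 0) (\<lambda>e. p_eps f l r c e q)"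

definition critical_speed :: "(real \<Rightarrow> real) \<Rightarrow> real \<Rightarrow> real \<Rightarrow> real" where
  "critical_speed f l r = Inf {c. c > 0 \<and> p_lim f l r c r < 0}"

text \<open>
  Bounded classical solutions of \<open>u\<^sub>t = u\<^sub>x\<^sub>x + f u\<close>, with \<open>u x t\<close> for position
  \<open>x\<close> and time \<open>t\<close>. Continuity of \<open>u\<close> and of its derivatives is joint in \<open>(x, t)\<close>.
\<close>

definition is_solution ::
    "(real \<Rightarrow> real) \<Rightarrow> (real \<Rightarrow> real) \<Rightarrow> (real \<Rightarrow> real \<Rightarrow> real) \<Rightarrow> bool" where
  "is_solution f u0 u \<longleftrightarrow>
     bounded ((\<lambda>(x, t). u x t) ` (UNIV \<times> {0..})) \<and>
     continuous_on (UNIV \<times> {0..}) (\<lambda>(x, t). u x t) \<and>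
     (\<exists>ut ux uxx.
        (\<forall>x. \<forall>t>0.
           ((\<lambda>s. u x s) has_real_derivative ut x t) (at t) \<and>
           ((\<lambda>y. u y t) has_real_derivative ux x t) (at x) \<and>
           ((\<lambda>y. ux y t) has_real_derivative uxx x t) (at x) \<and>
           ut x t = uxx x t + f (u x t)) \<and>
        continuous_on (UNIV \<times> {0<..}) (\<lambda>(x, t). ut x t) \<and>
        continuous_on (UNIV \<times> {0<..}) (\<lambda>(x, t). ux x t) \<and>
        continuous_on (UNIV \<times> {0<..}) (\<lambda>(x, t). uxx x t)) \<and>
     (\<forall>x. u x 0 = u0 x)"

end

theory Submission
  imports Defs
begin

text \<open>
  With \<open>v = - p\<close>, a curve \<open>v > 0\<close> over a range of values \<open>q\<close> is the downward slope of a decreasing profile,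
  \<open>U' = - v U\<close>, and \<open>U (x - c * t)\<close> is a subsolution or a supersolution according to the sign of
  \<open>v * v' - c * v + f\<close>. Above the critical speed the limiting trajectory stays positive up to \<open>r\<close>
  and gives a supersolution decaying to \<open>l\<close>; for the lower step it is prolonged past \<open>S\<^sub>2\<close> by a
  trajectory of the upper step, which works because \<open>c\<^sub>1\<^sub>2 > c\<^sub>2\<^sub>3\<close>.
  Below the critical speed some trajectory of a speed \<open>c'' > c\<close> reaches \<open>r\<close> with an arbitrarily small value,
  so \<open>v - (c'' - c) * (q - l)\<close> vanishes at some \<open>q\<^sub>1 < r\<close>; it is a subsolution profile of speed \<open>c\<close>
  that rises from slightly below \<open>l\<close> to \<open>q\<^sub>1\<close>. It can be compared with \<open>u\<close> wherever \<open>u\<close> is already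
  known to be nearly above \<open>l\<close>, so the two steps are treated one after the other. Once \<open>u\<close> exceeds some
  \<open>q > l\<close> behind a moving point, the lower bound on \<open>f\<close> between \<open>q\<close> and \<open>r\<close> pushes it up to \<open>r\<close>.
\<close>

section \<open>Scalar differential equations\<close>

text \<open>Two singularities shape the argument. The field \<open>c - f q / v\<close> is not
  Lipschitz at \<open>v = 0\<close>, so existence, ordering and passage to the limit of trajectories
  all go through the field with \<open>max v \<eta>\<close> in the denominator, together with a
  proof that the curves in question stay above \<open>\<eta>\<close>. The limiting trajectory
  moreover starts at \<open>v = 0\<close>; it is controlled through a lower bound on trajectories
  away from \<open>l\<close> that does not depend on the starting value \<open>e\<close>. A profile
  comes from inverting an antiderivative of \<open>- 1 / v\<close>. It is defined on the whole line
  only if the integral of \<open>1 / v\<close> diverges at both ends, which is why every curve is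
  accompanied by a linear upper bound at each end of its range. No estimate is made at the speed
  \<open>c\<close> of the moving observer itself: each front runs at a slightly different speed, and
  the difference of speeds, multiplied by \<open>t\<close>, eventually absorbs every shift, waiting
  time and offset \<open>x\<close>.\<close>

lemma picard_lindelof_interval:
  fixes F :: "real \<Rightarrow> real \<Rightarrow> real"
  assumes lr: "l \<le> r"
    and cont: "continuous_on ({l..r} \<times> UNIV) (\<lambda>(s, y). F s y)"
    and lip: "\<And>s y z. s \<in> {l..r} \<Longrightarrow> \<bar>F s y - F s z\<bar> \<le> L * \<bar>y - z\<bar>"
  obtains y where "y l = y0"
    and "\<And>s. s \<in> {l..r} \<Longrightarrow> (y has_real_derivative F s (y s)) (at s within {l..r})"
proof -
  define M where "M = max L 1"
  have M: "M \<ge> 1" "L \<le> M" by (auto simp: M_def)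
  \<comment> \<open>Bielecki weight: the fixed point is sought for \<open>z = y / w\<close> with
    \<open>w s = exp (K * (s - l))\<close>. Since \<open>K = 2 * M\<close>, integrating
    \<open>M * w\<close> gives at most \<open>w / 2\<close>, so the map contracts by 1/2 on the
    whole interval at once.\<close>
  define K where "K = 2 * M"
  have K: "K > 0" using M by (simp add: K_def)
  \<comment> \<open>Clamping turns a continuous function on \<open>{l..r}\<close> into a bounded
    continuous function on the line, a point of the complete space in which Banach's theorem is
    applied.\<close>
  define cl where "cl s = max l (min r s)" for s
  have cl: "cl s \<in> {l..r}" for s using lr by (auto simp: cl_def)
  have cl_id: "s \<in> {l..r} \<Longrightarrow> cl s = s" for s by (auto simp: cl_def)
  have cl_cont: "continuous_on UNIV cl" unfolding cl_def by (intro continuous_intros)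
  define w where "w s = exp (K * (s - l))" for s
  have w_pos: "w s > 0" for s by (simp add: w_def)
  have w_cont: "continuous_on A w" for A unfolding w_def by (intro continuous_intros)
  define G where "G z s = F s (w s * z s)" for z :: "real \<Rightarrow> real" and s
  define H where "H z s = (y0 + integral {l..s} (G z)) / w s" for z :: "real \<Rightarrow> real" and s
  have G_cont: "continuous_on {l..r} (G z)" if "continuous_on {l..r} z" for z
  proof -
    have "continuous_on {l..r} (\<lambda>s. (s, w s * z s))"
      by (intro continuous_intros w_cont that)
    from continuous_on_compose2[OF cont this] show ?thesis
      by (auto simp: G_def)
  qed
  have H_cont: "continuous_on {l..r} (H z)" if "continuous_on {l..r} z" for z
    unfolding H_def
    using indefinite_integral_continuous_1[OF integrable_continuous_real[OF G_cont[OF that]]] w_pos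
    by (intro continuous_intros w_cont) (auto simp: less_imp_neq[symmetric])
  have T_bc: "(\<lambda>s. H z (cl s)) \<in> bcontfun" if "continuous_on {l..r} z" for z
  proof -
    have "continuous_on UNIV (\<lambda>s. H z (cl s))"
      by (rule continuous_on_compose2[OF H_cont[OF that] cl_cont]) (use cl in auto)
    moreover have "bounded (H z ` {l..r})"
      using H_cont[OF that] compact_continuous_image compact_imp_bounded by blast
    then have "bounded (range (\<lambda>s. H z (cl s)))"
      by (rule bounded_subset) (use cl in auto)
    ultimately show ?thesis by (simp add: bcontfun_def)
  qed
  define T where "T z = Bcontfun (\<lambda>s. H (apply_bcontfun z) (cl s))" for z :: "real \<Rightarrow>\<^sub>C real"
  have T: "apply_bcontfun (T z) s = H (apply_bcontfun z) (cl s)" for z s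
    unfolding T_def using Bcontfun_inverse[OF T_bc[of "apply_bcontfun z"]] by auto
  have contr: "dist (T z1) (T z2) \<le> (1/2) * dist z1 z2" for z1 z2
  proof (rule dist_bound)
    fix s
    let ?s = "cl s" and ?d = "dist z1 z2"
    have s: "?s \<in> {l..r}" by (rule cl)
    have int: "G (apply_bcontfun z) integrable_on {l..?s}" for z
      using s by (intro integrable_continuous_real continuous_on_subset[OF G_cont]) auto
    have wint: "((\<lambda>t. M * w t * ?d) has_integral (w ?s / 2 * ?d - w l / 2 * ?d)) {l..?s}"
    proof (rule fundamental_theorem_of_calculus)
      show "((\<lambda>t. w t / 2 * ?d) has_vector_derivative M * w t * ?d) (at t within {l..?s})" for t
        unfolding has_real_derivative_iff_has_vector_derivative[symmetric] w_def
        by (auto intro!: derivative_eq_intros simp: K_def)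
    qed (use s in auto)
    have "norm (integral {l..?s} (\<lambda>t. G z1 t - G z2 t)) \<le> integral {l..?s} (\<lambda>t. M * w t * ?d)"
    proof (rule integral_norm_bound_integral)
      fix t assume t: "t \<in> {l..?s}"
      have "\<bar>z1 t - z2 t\<bar> \<le> ?d" using dist_bounded[of z1 t z2] by (simp add: dist_real_def)
      then have "w t * \<bar>z1 t - z2 t\<bar> \<le> w t * ?d" using w_pos[of t] by (intro mult_left_mono) auto
      then have "M * \<bar>w t * z1 t - w t * z2 t\<bar> \<le> M * (w t * ?d)"
        using M w_pos[of t] by (intro mult_left_mono) (auto simp: abs_mult right_diff_distrib[symmetric])
      moreover have "\<bar>G z1 t - G z2 t\<bar> \<le> L * \<bar>w t * z1 t - w t * z2 t\<bar>"
        unfolding G_def using t s by (intro lip) auto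
      moreover have "\<dots> \<le> M * \<bar>w t * z1 t - w t * z2 t\<bar>" using M by (intro mult_right_mono) auto
      ultimately show "norm (G z1 t - G z2 t) \<le> M * w t * ?d" by simp
    qed (use int wint in \<open>auto intro!: integrable_diff\<close>)
    also have "\<dots> \<le> w ?s / 2 * ?d"
      using integral_unique[OF wint] w_pos[of l] by simp
    finally have "\<bar>integral {l..?s} (G z1) - integral {l..?s} (G z2)\<bar> \<le> w ?s / 2 * ?d"
      using int by (simp add: integral_diff)
    then have "\<bar>integral {l..?s} (G z1) - integral {l..?s} (G z2)\<bar> / w ?s \<le> ?d / 2"
      using w_pos[of ?s] by (simp add: field_simps)
    then show "dist (T z1 s) (T z2 s) \<le> (1/2) * ?d"
      using w_pos[of ?s] unfolding T H_def dist_real_def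
      by (simp add: diff_divide_distrib[symmetric])
  qed
  obtain z where z: "T z = z"
    using banach_fix_type[of "1/2" T] contr by auto
  define y where "y s = w s * apply_bcontfun z s" for s
  have yeq: "y s = y0 + integral {l..s} (G z)" if "s \<in> {l..r}" for s
    using arg_cong[OF z, of "\<lambda>g. apply_bcontfun g s"] that w_pos[of s]
    by (auto simp: T cl_id H_def y_def field_simps)
  have "y l = y0" using yeq[of l] lr by simp
  moreover have "(y has_real_derivative F s (y s)) (at s within {l..r})" if s: "s \<in> {l..r}" for s
  proof -
    have "((\<lambda>s. y0 + integral {l..s} (G z)) has_real_derivative G z s) (at s within {l..r})"
      using integral_has_real_derivative[OF G_cont s] by (auto intro!: derivative_eq_intros)
    then have "(y has_real_derivative G z s) (at s within {l..r})"
      by (rule has_field_derivative_transform_within[where d = 1]) (use s yeq in auto)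
    then show ?thesis by (simp add: G_def y_def)
  qed
  ultimately show thesis by (rule that)
qed

section \<open>Scalar differential inequalities and continuous dependence\<close>

lemma last_nonpos:
  fixes d :: "real \<Rightarrow> real"
  assumes "a < b" and cont: "continuous_on {a..b} d" and "d a \<le> 0" "d b > 0"
  obtains s where "a \<le> s" "s < b" "d s = 0" "\<And>q. s < q \<Longrightarrow> q \<le> b \<Longrightarrow> d q > 0"
proof -
  define A where "A = {q \<in> {a..b}. d q \<le> 0}"
  have "closed A"
    unfolding A_def using continuous_on_closed_Collect_le[OF cont continuous_on_const] by simp
  moreover have "a \<in> A" "A \<subseteq> {a..b}" using assms by (auto simp: A_def)
  ultimately have "compact A" "A \<noteq> {}"
    using closed_Int_compact[of A "{a..b}"] by (auto simp: Int_absorb2)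
  then obtain s where s: "s \<in> A" "\<And>q. q \<in> A \<Longrightarrow> q \<le> s"
    using compact_attains_sup[of A] by blast
  have sb: "s < b" using s assms by (cases "s = b") (auto simp: A_def)
  have pos: "d q > 0" if "s < q" "q \<le> b" for q
    using s(2)[of q] that s(1) by (force simp: A_def)
  have "d s = 0"
  proof (rule ccontr)
    assume "d s \<noteq> 0"
    then have neg: "d s < 0" using s(1) by (auto simp: A_def)
    have "continuous_on {s..b} d" using s(1) by (auto intro: continuous_on_subset[OF cont] simp: A_def)
    then obtain x where "s \<le> x" "x \<le> b" "d x = 0"
      using IVT'[of d s 0 b] neg assms(4) sb by auto
    with neg pos[of x] show False by (cases "x = s") auto
  qed
  with s sb pos show thesis by (intro that[of s]) (auto simp: A_def)
qed

text \<open>The inequality is asked only where \<open>d > 0\<close>, which suits curves whose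
  equation holds only while they are positive. After the last zero of \<open>d\<close> before
  \<open>b\<close>, the product \<open>exp (- C * q) * d q\<close> cannot increase, so it cannot
  become positive.\<close>

lemma gronwall_nonpos:
  fixes d :: "real \<Rightarrow> real"
  assumes "a \<le> b" and cont: "continuous_on {a..b} d" and "d a \<le> 0"
    and D: "\<And>q. a < q \<Longrightarrow> q < b \<Longrightarrow> d q > 0 \<Longrightarrow> \<exists>D. (d has_real_derivative D) (at q) \<and> D \<le> C * d q"
  shows "d b \<le> 0"
proof (rule ccontr)
  assume "\<not> d b \<le> 0"
  then have "d b > 0" by simp
  then have "a < b" using assms by (cases "a = b") auto
  from last_nonpos[OF this cont \<open>d a \<le> 0\<close> \<open>d b > 0\<close>]
  obtain s where s: "a \<le> s" "s < b" "d s = 0" and pos: "\<And>q. s < q \<Longrightarrow> q \<le> b \<Longrightarrow> d q > 0" by blast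
  define g where "g q = exp (- C * q) * d q" for q
  have "g b \<le> g s"
  proof (rule DERIV_nonpos_imp_decreasing_open[OF less_imp_le[OF s(2)]])
    fix q assume q: "s < q" "q < b"
    obtain D where D: "(d has_real_derivative D) (at q)" "D \<le> C * d q"
      using assms(4)[of q] pos[of q] q s by auto
    have "(g has_real_derivative exp (- C * q) * (D - C * d q)) (at q)"
      unfolding g_def by (auto intro!: derivative_eq_intros D(1) simp: algebra_simps)
    moreover have "exp (- C * q) * (D - C * d q) \<le> 0" using D(2) by (simp add: mult_nonneg_nonpos)
    ultimately show "\<exists>y. (g has_real_derivative y) (at q) \<and> y \<le> 0" by blast
  next
    show "continuous_on {s..b} g" unfolding g_def
      using s by (intro continuous_intros continuous_on_subset[OF cont]) auto
  qed
  then show False using s(3) \<open>d b > 0\<close> by (simp add: g_def mult_le_0_iff)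
qed

lemma ode_dependence:
  fixes y z :: "real \<Rightarrow> real"
  assumes "a \<le> b" and cont: "continuous_on {a..b} y" "continuous_on {a..b} z"
    and y: "\<And>q. a < q \<Longrightarrow> q < b \<Longrightarrow> (y has_real_derivative F q (y q)) (at q)"
    and z: "\<And>q. a < q \<Longrightarrow> q < b \<Longrightarrow> (z has_real_derivative F q (z q)) (at q)"
    and lip: "\<And>q. a < q \<Longrightarrow> q < b \<Longrightarrow> \<bar>F q (y q) - F q (z q)\<bar> \<le> L * \<bar>y q - z q\<bar>"
  shows "\<bar>y b - z b\<bar> \<le> \<bar>y a - z a\<bar> * exp (L * (b - a))"
proof -
  have *: "y b - z b - \<bar>y a - z a\<bar> * exp (L * (b - a)) \<le> 0"
    if "continuous_on {a..b} y" "continuous_on {a..b} z"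
    and y: "\<And>q. a < q \<Longrightarrow> q < b \<Longrightarrow> (y has_real_derivative F q (y q)) (at q)"
    and z: "\<And>q. a < q \<Longrightarrow> q < b \<Longrightarrow> (z has_real_derivative F q (z q)) (at q)"
    and lip: "\<And>q. a < q \<Longrightarrow> q < b \<Longrightarrow> \<bar>F q (y q) - F q (z q)\<bar> \<le> L * \<bar>y q - z q\<bar>"
    for y z :: "real \<Rightarrow> real"
  proof (rule gronwall_nonpos[of a b "\<lambda>q. y q - z q - \<bar>y a - z a\<bar> * exp (L * (q - a))" L])
    show "continuous_on {a..b} (\<lambda>q. y q - z q - \<bar>y a - z a\<bar> * exp (L * (q - a)))"
      by (intro continuous_intros that)
  next
    fix q assume q: "a < q" "q < b" and pos: "y q - z q - \<bar>y a - z a\<bar> * exp (L * (q - a)) > 0"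
    let ?D = "F q (y q) - F q (z q) - \<bar>y a - z a\<bar> * (exp (L * (q - a)) * L)"
    have "y q > z q" using pos by (smt (verit) exp_gt_zero mult_nonneg_nonneg)
    then have "?D \<le> L * (y q - z q - \<bar>y a - z a\<bar> * exp (L * (q - a)))"
      using lip[OF q] by (simp add: algebra_simps)
    moreover have "((\<lambda>q. y q - z q - \<bar>y a - z a\<bar> * exp (L * (q - a))) has_real_derivative ?D) (at q)"
      by (auto intro!: derivative_eq_intros y z q)
    ultimately show "\<exists>D. ((\<lambda>q. y q - z q - \<bar>y a - z a\<bar> * exp (L * (q - a))) has_real_derivative D) (at q)
        \<and> D \<le> L * (y q - z q - \<bar>y a - z a\<bar> * exp (L * (q - a)))" by blast
  qed (use assms in auto)
  have "y b - z b \<le> \<bar>y a - z a\<bar> * exp (L * (b - a))"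
    using *[OF cont y z lip] by simp
  moreover have lip': "\<bar>F q (z q) - F q (y q)\<bar> \<le> L * \<bar>z q - y q\<bar>" if "a < q" "q < b" for q
    using lip[OF that] by (simp only: abs_minus_commute)
  have "z b - y b \<le> \<bar>y a - z a\<bar> * exp (L * (b - a))"
    using *[OF cont(2,1) z y lip'] by (simp add: abs_minus_commute[of "z a" "y a"])
  ultimately show ?thesis by (intro abs_leI) auto
qed

text \<open>With \<open>a = f q\<close> this is the trajectory field with its singularity at
  \<open>0\<close> cut off. The difference is \<open>a\<close> times the difference of the truncated
  values over their product; both values are at least \<open>\<eta>\<close>, and truncation does not
  increase distances.\<close>

lemma cutoff_lipschitz:
  fixes y z :: real
  assumes "\<eta> > 0" and "\<bar>a\<bar> \<le> B"
  shows "\<bar>(c - a / max y \<eta>) - (c - a / max z \<eta>)\<bar> \<le> B / \<eta>\<^sup>2 * \<bar>y - z\<bar>"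
proof -
  let ?y = "max y \<eta>" and ?z = "max z \<eta>"
  have pos: "?y > 0" "?z > 0" "\<eta>\<^sup>2 > 0" using assms by auto
  have "\<eta> * \<eta> \<le> ?y * ?z" using assms by (intro mult_mono) auto
  then have "1 / (?y * ?z) \<le> 1 / \<eta>\<^sup>2"
    using assms by (intro divide_left_mono) (auto simp: power2_eq_square)
  moreover have "\<bar>?y - ?z\<bar> \<le> \<bar>y - z\<bar>" by auto
  ultimately have "\<bar>?y - ?z\<bar> * (1 / (?y * ?z)) \<le> \<bar>y - z\<bar> * (1 / \<eta>\<^sup>2)"
    using pos by (rule_tac mult_mono) auto
  then have "\<bar>a\<bar> * (\<bar>?y - ?z\<bar> * (1 / (?y * ?z))) \<le> B * (\<bar>y - z\<bar> * (1 / \<eta>\<^sup>2))"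
    using assms pos by (rule_tac mult_mono) auto
  moreover have "(c - a / ?y) - (c - a / ?z) = a * ((?y - ?z) * (1 / (?y * ?z)))"
    using pos by (simp add: field_simps)
  ultimately show ?thesis using pos by (simp add: abs_mult)
qed

section \<open>Trajectories and the critical speed\<close>

definition downward_trajectory ::
    "(real \<Rightarrow> real) \<Rightarrow> real \<Rightarrow> real \<Rightarrow> real \<Rightarrow> real \<Rightarrow> (real \<Rightarrow> real) \<Rightarrow> bool" where
  "downward_trajectory f l r c e v \<longleftrightarrow>
     continuous_on {l..r} v \<and> v l = e \<and> (\<forall>q\<in>{l..r}. 0 \<le> v q) \<and>
     (\<forall>q\<in>{l..r}. 0 < v q \<longrightarrow> (v has_real_derivative (c - f q / v q)) (at q within {l..r})) \<and>
     (\<forall>q\<in>{l..r}. v q = 0 \<longrightarrow> (\<forall>q'\<in>{q..r}. v q' = 0))"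

lemma trajectory_iff_downward:
  "trajectory f l r c e p \<longleftrightarrow> downward_trajectory f l r c e (\<lambda>q. - p q)"
proof -
  have "continuous_on {l..r} p \<longleftrightarrow> continuous_on {l..r} (\<lambda>q. - p q)"
    using continuous_on_minus[of "{l..r}" p] continuous_on_minus[of "{l..r}" "\<lambda>q. - p q"] by auto
  moreover have "(p has_real_derivative - c - f q / p q) (at q within {l..r}) \<longleftrightarrow>
      ((\<lambda>q. - p q) has_real_derivative c - f q / - p q) (at q within {l..r})" for q
    using DERIV_cong[OF DERIV_minus[of p "- c - f q / p q" q "{l..r}"], of "c - f q / - p q"]
      DERIV_cong[OF DERIV_minus[of "\<lambda>q. - p q" "c - f q / - p q" q "{l..r}"], of "- c - f q / p q"]
    by fastforce
  moreover have "p l = - e \<longleftrightarrow> - p l = e" by linarith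
  ultimately show ?thesis
    unfolding trajectory_def downward_trajectory_def by simp
qed

text \<open>The linear bound at \<open>l\<close> is what the regularity of \<open>f\<close>
  contributes. It keeps trajectories of speed \<open>K + 1\<close> above the ray
  \<open>q - l\<close>, so that some speed is admissible, and it bounds \<open>f\<close> on the
  interval, which gives the Lipschitz constants of the truncated fields.\<close>

locale monostable =
  fixes f :: "real \<Rightarrow> real" and l r K :: real
  assumes l_less_r: "l < r"
    and f_cont: "continuous_on {l..r} f"
    and f_zero: "f l = 0" "f r = 0"
    and f_pos: "\<And>q. l < q \<Longrightarrow> q < r \<Longrightarrow> f q > 0"
    and f_bound: "\<And>q. l \<le> q \<Longrightarrow> q \<le> r \<Longrightarrow> f q \<le> K * (q - l)"
begin

lemma f_nonneg: "q \<in> {l..r} \<Longrightarrow> f q \<ge> 0"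
  using f_zero f_pos[of q] by (cases "q = l"; cases "q = r") auto

lemma K_nonneg: "K \<ge> 0"
proof -
  have "0 \<le> K * (r - l)" using f_bound[of r] f_zero l_less_r by auto
  then show ?thesis using l_less_r by (simp add: zero_le_mult_iff)
qed

lemma f_abs_le: "q \<in> {l..r} \<Longrightarrow> \<bar>f q\<bar> \<le> K * (r - l)"
  using f_nonneg[of q] f_bound[of q] K_nonneg mult_left_mono[of "q - l" "r - l" K] by auto

abbreviation traj where "traj \<equiv> downward_trajectory f l r"

lemma trajD:
  assumes "traj c e v"
  shows "continuous_on {l..r} v" "v l = e" "\<And>q. q \<in> {l..r} \<Longrightarrow> v q \<ge> 0"
    "\<And>q. q \<in> {l..r} \<Longrightarrow> 0 < v q \<Longrightarrow> (v has_real_derivative (c - f q / v q)) (at q within {l..r})"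
    "\<And>q. l < q \<Longrightarrow> q < r \<Longrightarrow> 0 < v q \<Longrightarrow> (v has_real_derivative (c - f q / v q)) (at q)"
    "\<And>q q'. l \<le> q \<Longrightarrow> q \<le> q' \<Longrightarrow> q' \<le> r \<Longrightarrow> v q' > 0 \<Longrightarrow> v q > 0"
proof -
  show "continuous_on {l..r} v" "v l = e" and nn: "\<And>q. q \<in> {l..r} \<Longrightarrow> v q \<ge> 0"
    and d: "\<And>q. q \<in> {l..r} \<Longrightarrow> 0 < v q \<Longrightarrow> (v has_real_derivative (c - f q / v q)) (at q within {l..r})"
    using assms by (auto simp: downward_trajectory_def)
  show "\<And>q. l < q \<Longrightarrow> q < r \<Longrightarrow> 0 < v q \<Longrightarrow> (v has_real_derivative (c - f q / v q)) (at q)"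
    using d at_within_Icc_at[of l _ r] by (metis atLeastAtMost_iff less_imp_le)
  show "v q > 0" if "l \<le> q" "q \<le> q'" "q' \<le> r" "v q' > 0" for q q'
  proof (rule ccontr)
    assume "\<not> v q > 0"
    then have "v q = 0" using nn[of q] that by auto
    then have "v q' = 0" using assms that unfolding downward_trajectory_def by auto
    then show False using that by simp
  qed
qed

text \<open>The curve follows the truncated solutions as long as some cutoff leaves them untouched
  and is \<open>0\<close> afterwards. The delicate point is continuity where no cutoff works any
  more: the value must tend to \<open>0\<close> there instead of jumping from a positive
  level.\<close>

lemma traj_exists:
  assumes e: "e > 0"
  shows "\<exists>v. traj c e v"
proof -
  define F where "F \<eta> q y = c - f q / max y \<eta>" for \<eta> q y :: real
  define B where "B = K * (r - l)"
  have lip: "\<bar>F \<eta> q y - F \<eta> q z\<bar> \<le> B / \<eta>\<^sup>2 * \<bar>y - z\<bar>" if "\<eta> > 0" "q \<in> {l..r}" for \<eta> q y z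
    unfolding F_def B_def using that f_abs_le by (intro cutoff_lipschitz) auto
  have "\<exists>y. y l = e \<and> (\<forall>q\<in>{l..r}. (y has_real_derivative F \<eta> q (y q)) (at q within {l..r}))"
    if \<eta>: "\<eta> > 0" for \<eta>
  proof -
    have "continuous_on ({l..r} \<times> UNIV) (\<lambda>(q, y). F \<eta> q y)"
      unfolding F_def case_prod_unfold using \<eta>
      by (intro continuous_intros continuous_on_compose2[OF f_cont]) auto
    from picard_lindelof_interval[OF less_imp_le[OF l_less_r] this lip[OF \<eta>]]
    show ?thesis by metis
  qed
  then obtain Y where Yl: "\<And>\<eta>. \<eta> > 0 \<Longrightarrow> Y \<eta> l = e"
    and Yd: "\<And>\<eta> q. \<eta> > 0 \<Longrightarrow> q \<in> {l..r} \<Longrightarrow> (Y \<eta> has_real_derivative F \<eta> q (Y \<eta> q)) (at q within {l..r})"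
    by metis
  have Yc: "continuous_on {l..r} (Y \<eta>)" if "\<eta> > 0" for \<eta>
    using Yd[OF that] by (meson DERIV_continuous continuous_on_eq_continuous_within)
  have Yd': "(Y \<eta> has_real_derivative F \<eta> q (Y \<eta> q)) (at q)" if "\<eta> > 0" "l < q" "q < r" for \<eta> q
    using Yd[of \<eta> q] that at_within_Icc_at[of l q r] by auto
  \<comment> \<open>Where \<open>Y \<eta> \<ge> \<eta>\<close> the cutoff is inactive; the trajectory is glued from these pieces as \<open>\<eta>\<close> decreases.\<close>
  define good where "good \<eta> q \<longleftrightarrow> \<eta> > 0 \<and> (\<forall>q'\<in>{l..q}. Y \<eta> q' \<ge> \<eta>)" for \<eta> q
  have agree: "Y \<eta>' q = Y \<eta> q" if "good \<eta> t" "0 < \<eta>'" "\<eta>' \<le> \<eta>" "q \<in> {l..t}" "t \<le> r" for \<eta> \<eta>' q t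
  proof -
    have pos: "\<eta> > 0" and ge: "\<And>q'. q' \<in> {l..t} \<Longrightarrow> Y \<eta> q' \<ge> \<eta>" using that(1) by (auto simp: good_def)
    have "\<bar>Y \<eta>' q - Y \<eta> q\<bar> \<le> \<bar>Y \<eta>' l - Y \<eta> l\<bar> * exp (B / \<eta>'\<^sup>2 * (q - l))"
    proof (rule ode_dependence[where F = "F \<eta>'"])
      fix s assume s: "l < s" "s < q"
      have "F \<eta> s (Y \<eta> s) = F \<eta>' s (Y \<eta> s)"
        using ge[of s] s that by (simp add: F_def max_def)
      then show "(Y \<eta> has_real_derivative F \<eta>' s (Y \<eta> s)) (at s)"
        using Yd'[OF pos, of s] s that by auto
      show "(Y \<eta>' has_real_derivative F \<eta>' s (Y \<eta>' s)) (at s)"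
        using Yd'[of \<eta>' s] s that by auto
      show "\<bar>F \<eta>' s (Y \<eta>' s) - F \<eta>' s (Y \<eta> s)\<bar> \<le> B / \<eta>'\<^sup>2 * \<bar>Y \<eta>' s - Y \<eta> s\<bar>"
        using lip[of \<eta>' s] s that by auto
    qed (use that pos in \<open>auto intro!: continuous_on_subset[OF Yc]\<close>)
    then show ?thesis using Yl[of \<eta>] Yl[of \<eta>'] pos that by simp
  qed
  have good_mono: "good \<eta>' q'" if "good \<eta> q" "0 < \<eta>'" "\<eta>' \<le> \<eta>" "q' \<le> q" "q \<le> r" for \<eta> \<eta>' q q'
  proof -
    have "\<forall>s\<in>{l..q'}. Y \<eta>' s \<ge> \<eta>'"
    proof
      fix s assume s: "s \<in> {l..q'}"
      then have "Y \<eta>' s = Y \<eta> s" using that by (intro agree[OF that(1-3)]) auto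
      moreover have "Y \<eta> s \<ge> \<eta>" using that s by (auto simp: good_def)
      ultimately show "Y \<eta>' s \<ge> \<eta>'" using that(3) by simp
    qed
    then show ?thesis using that by (simp add: good_def)
  qed
  define ok where "ok q \<longleftrightarrow> (\<exists>\<eta>. good \<eta> q)" for q
  define v where "v q = (if ok q then Y (SOME \<eta>. good \<eta> q) q else 0)" for q
  have v_eq: "v q = Y \<eta> q" if "good \<eta> t" "q \<in> {l..t}" "t \<le> r" for \<eta> q t
  proof -
    have g1: "good \<eta> q" using good_mono[OF that(1), of \<eta> q] that by (auto simp: good_def)
    then have ok: "ok q" by (auto simp: ok_def)
    define \<eta>1 where "\<eta>1 = (SOME \<eta>. good \<eta> q)"
    have g2: "good \<eta>1 q" unfolding \<eta>1_def using g1 by (rule someI)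
    have pos: "\<eta> > 0" "\<eta>1 > 0" using g1 g2 by (auto simp: good_def)
    have "Y (min \<eta> \<eta>1) q = Y \<eta> q" "Y (min \<eta> \<eta>1) q = Y \<eta>1 q"
      using that pos by (auto intro!: agree[OF g1] agree[OF g2])
    then show ?thesis using ok by (simp add: v_def \<eta>1_def)
  qed
  \<comment> \<open>Halving the cutoff leaves a margin at \<open>q\<close>, so \<open>v\<close>
    coincides with one truncated solution on both sides of \<open>q\<close>; the derivative at
    \<open>q\<close> is read off from it.\<close>
  have extend: "\<exists>d>0. good (\<eta> / 2) (min (q + d) r)" if g: "good \<eta> q" and q: "q \<in> {l..r}" for \<eta> q
  proof -
    have pos: "\<eta> > 0" using g by (simp add: good_def)
    have g': "good (\<eta>/2) q" using good_mono[OF g, of "\<eta>/2" q] pos q by auto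
    have ge: "\<And>s. s \<in> {l..q} \<Longrightarrow> Y (\<eta>/2) s \<ge> \<eta>"
      using agree[OF g, of "\<eta>/2"] pos q g by (auto simp: good_def)
    have "Y (\<eta>/2) q > \<eta>/2" using ge[of q] q pos by auto
    moreover have "(Y (\<eta>/2) \<longlongrightarrow> Y (\<eta>/2) q) (at q within {l..r})"
      using Yc[of "\<eta>/2"] pos q by (auto simp: continuous_on)
    ultimately have "eventually (\<lambda>s. Y (\<eta>/2) s > \<eta>/2) (at q within {l..r})"
      by (intro order_tendstoD)
    then obtain d where d: "d > 0" "\<And>s. s \<in> {l..r} \<Longrightarrow> s \<noteq> q \<Longrightarrow> dist s q < d \<Longrightarrow> Y (\<eta>/2) s > \<eta>/2"
      unfolding eventually_at by auto
    have "good (\<eta>/2) (min (q + d/2) r)"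
      unfolding good_def
    proof (intro conjI ballI)
      fix s assume s: "s \<in> {l..min (q + d/2) r}"
      show "\<eta>/2 \<le> Y (\<eta>/2) s"
        using ge[of s] d(2)[of s] s pos d(1) by (cases "s \<le> q") (auto simp: dist_real_def)
    qed (use pos in auto)
    then show ?thesis using d(1) by (intro exI[of _ "d/2"]) auto
  qed
  have v_l: "v l = e" and ok_l: "ok l"
  proof -
    have "good e l" using e Yl by (auto simp: good_def)
    then show "v l = e" "ok l" using v_eq[of e l l] l_less_r Yl e by (auto simp: ok_def)
  qed
  have ok_down: "ok q'" if "ok q" "q' \<le> q" "q \<le> r" for q q'
    using that good_mono by (auto simp: ok_def) (metis good_def order_refl)
  have ok_pos: "v q > 0" if "ok q" "q \<in> {l..r}" for q
  proof -
    obtain \<eta> where g: "good \<eta> q" using \<open>ok q\<close> by (auto simp: ok_def)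
    then have "v q = Y \<eta> q" "Y \<eta> q \<ge> \<eta>" "\<eta> > 0"
      using v_eq[OF g, of q] that by (auto simp: good_def)
    then show ?thesis by linarith
  qed
  have deriv: "(v has_real_derivative c - f q / v q) (at q within {l..r})" if "ok q" "q \<in> {l..r}" for q
  proof -
    obtain \<eta> where g: "good \<eta> q" using \<open>ok q\<close> by (auto simp: ok_def)
    then have pos: "\<eta> > 0" by (auto simp: good_def)
    obtain d where d: "d > 0" "good (\<eta>/2) (min (q + d) r)" using extend[OF g \<open>q \<in> {l..r}\<close>] by auto
    have eq: "v s = Y (\<eta>/2) s" if "s \<in> {l..min (q + d) r}" for s using v_eq[OF d(2) that] by auto
    have "Y (\<eta>/2) q \<ge> \<eta>/2" using d that by (auto simp: good_def)
    then have "F (\<eta>/2) q (Y (\<eta>/2) q) = c - f q / v q"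
      using eq[of q] d(1) that(2) by (simp add: F_def max_def)
    then have "(Y (\<eta>/2) has_real_derivative c - f q / v q) (at q within {l..r})"
      using Yd[of "\<eta>/2" q] pos that by auto
    then show ?thesis
      by (rule has_field_derivative_transform_within[where d = d])
        (use that d(1) eq in \<open>auto simp: dist_real_def\<close>)
  qed
  have v0: "v q = 0" if "\<not> ok q" for q using that by (simp add: v_def)
  \<comment> \<open>The slope is at most \<open>c\<close> because \<open>f / v \<ge> 0\<close>. The
    estimate is used backwards: a large value at \<open>b\<close> forces large values shortly before
    \<open>b\<close>, so \<open>v\<close> cannot dip towards \<open>0\<close> between large
    values.\<close>
  have growth: "v b \<le> v a + c * (b - a)" if "a \<in> {l..r}" "b \<in> {l..r}" "a \<le> b" "ok b" for a b
  proof -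
    have ok: "ok s" if "s \<le> b" for s using ok_down[OF \<open>ok b\<close> that] \<open>b \<in> {l..r}\<close> by auto
    have "v b - c * b \<le> v a - c * a"
    proof (rule DERIV_nonpos_imp_decreasing_open[OF \<open>a \<le> b\<close>])
      fix x assume x: "a < x" "x < b"
      have "(v has_real_derivative c - f x / v x) (at x)"
        using deriv[of x] ok[of x] x that at_within_Icc_at[of l x r] by auto
      then have "((\<lambda>x. v x - c * x) has_real_derivative (c - f x / v x) - c) (at x)"
        by (auto intro!: derivative_eq_intros)
      moreover have "f x / v x \<ge> 0" using f_nonneg[of x] ok_pos[of x] ok[of x] x that by auto
      ultimately show "\<exists>y. ((\<lambda>x. v x - c * x) has_real_derivative y) (at x) \<and> y \<le> 0" by force
    next
      have "continuous_on {a..b} v"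
        unfolding continuous_on_eq_continuous_within
      proof
        fix x assume "x \<in> {a..b}"
        then have "continuous (at x within {l..r}) v" using deriv[of x] ok[of x] that DERIV_continuous by auto
        then show "continuous (at x within {a..b}) v" by (rule continuous_within_subset) (use that in auto)
      qed
      then show "continuous_on {a..b} (\<lambda>x. v x - c * x)" by (intro continuous_intros)
    qed
    then show ?thesis by (simp add: algebra_simps)
  qed
  have cont: "continuous_on {l..r} v"
    unfolding continuous_on_eq_continuous_within
  proof
    fix t assume t: "t \<in> {l..r}"
    show "continuous (at t within {l..r}) v"
    proof (cases "ok t")
      case True
      then show ?thesis using deriv[of t] t DERIV_continuous by auto
    next
      case nok: False
      have "(v \<longlongrightarrow> 0) (at t within {l..r})"
      proof (rule order_tendstoI)
        fix a :: real assume "a < 0"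
        moreover have "v q \<ge> 0" if "q \<in> {l..r}" for q using ok_pos[OF _ that] v0[of q] by force
        ultimately show "eventually (\<lambda>x. a < v x) (at t within {l..r})"
          unfolding eventually_at by (force intro: exI[of _ 1])
      next
        fix \<sigma> :: real assume \<sigma>: "0 < \<sigma>"
        show "eventually (\<lambda>x. v x < \<sigma>) (at t within {l..r})"
        proof (rule ccontr)
          assume neg: "\<not> eventually (\<lambda>x. v x < \<sigma>) (at t within {l..r})"
          \<comment> \<open>If \<open>v\<close> does not tend to \<open>0\<close> at
            \<open>t\<close>, it is at least \<open>\<sigma>\<close> at points arbitrarily close to
            \<open>t\<close> on the left. Growth over a length \<open>d\<close> is at most
            \<open>\<sigma> / 2\<close>, so \<open>v \<ge> \<sigma> / 2\<close> from
            \<open>t - d\<close> up to \<open>t\<close>. Together with a cutoff that is good up to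
            \<open>t'\<close>, this bounds \<open>v\<close> below by a single \<open>\<eta>'\<close>
            on \<open>{l..<t}\<close>.\<close>
          define d where "d = \<sigma> / (2 * (\<bar>c\<bar> + 1))"
          have d: "d > 0" "\<bar>c\<bar> * d \<le> \<sigma>/2"
            using \<sigma> by (auto simp: d_def field_simps)
          have ex: "\<exists>x. x \<in> {l..r} \<and> x \<noteq> t \<and> dist x t < \<epsilon> \<and> v x \<ge> \<sigma> \<and> x < t \<and> ok x" if "\<epsilon> > 0" for \<epsilon>
          proof -
            obtain x where x: "x \<in> {l..r}" "x \<noteq> t" "dist x t < \<epsilon>" "v x \<ge> \<sigma>"
              using neg \<open>\<epsilon> > 0\<close> unfolding eventually_at by (auto simp: not_less dest!: spec[of _ \<epsilon>])
            have ok: "ok x" using x v0[of x] \<sigma> by force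
            moreover have "x < t" using ok_down[OF ok, of t] nok x by (cases "x < t") auto
            ultimately show ?thesis using x by blast
          qed
          have below: "ok q \<and> (t - d \<le> q \<longrightarrow> v q \<ge> \<sigma>/2)" if q: "q \<in> {l..<t}" for q
          proof -
            obtain x where x: "x \<in> {l..r}" "dist x t < t - q" "v x \<ge> \<sigma>" "x < t" "ok x"
              using ex[of "t - q"] q by auto
            have qx: "q < x" using x by (auto simp: dist_real_def)
            have "v x \<le> v q + c * (x - q)" using growth[of q x] qx x q by auto
            moreover have "c * (x - q) \<le> \<bar>c\<bar> * d" if "t - d \<le> q"
            proof -
              have "c * (x - q) \<le> \<bar>c\<bar> * (x - q)" using qx by (intro mult_right_mono) auto
              also have "\<dots> \<le> \<bar>c\<bar> * d" using that x by (intro mult_left_mono) auto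
              finally show ?thesis .
            qed
            ultimately show ?thesis using ok_down[OF x(5), of q] qx x d by force
          qed
          have lt: "l < t" using ex[of 1] by auto
          define t' where "t' = max l (t - d)"
          have t': "t' \<in> {l..<t}" using lt d by (auto simp: t'_def)
          obtain \<eta> where g: "good \<eta> t'" using below[OF t'] by (auto simp: ok_def)
          define \<eta>' where "\<eta>' = min \<eta> (\<sigma>/2)"
          have \<eta>': "\<eta>' > 0" "\<eta>' \<le> \<eta>" "\<eta>' \<le> \<sigma>/2" using g \<sigma> by (auto simp: \<eta>'_def good_def)
          have vge: "v q \<ge> \<eta>'" if "q \<in> {l..<t}" for q
          proof (cases "q \<le> t'")
            case True
            then show ?thesis using v_eq[OF g, of q] g that t' t \<eta>' by (force simp: good_def)
          next
            case False
            then show ?thesis using below[OF that] \<eta>' by (auto simp: t'_def)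
          qed
          \<comment> \<open>The cutoff that is good at \<open>q\<close> may shrink as
            \<open>q\<close> approaches \<open>t\<close>. Since its solution stays above
            \<open>\<eta>'\<close>, it also solves the problem with the fixed cutoff
            \<open>\<eta>'\<close>; by uniqueness the bound passes to \<open>Y \<eta>'\<close>,
            which is continuous up to \<open>t\<close>. Then \<open>t\<close> itself is good, a
            contradiction.\<close>
          have Yge: "Y \<eta>' q \<ge> \<eta>'" if q: "q \<in> {l..<t}" for q
          proof -
            obtain \<eta>1 where g1: "good \<eta>1 q" using below[OF q] by (auto simp: ok_def)
            define \<eta>2 where "\<eta>2 = min \<eta>1 \<eta>'"
            have g2: "good \<eta>2 q" using good_mono[OF g1, of \<eta>2 q] g1 \<eta>' q t by (auto simp: \<eta>2_def good_def)
            have \<eta>2: "0 < \<eta>2" "\<eta>2 \<le> \<eta>'" using g2 by (auto simp: \<eta>2_def good_def)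
            have Y2: "Y \<eta>2 s \<ge> \<eta>'" if "s \<in> {l..q}" for s
              using v_eq[OF g2 that] vge[of s] that q t by auto
            have "\<bar>Y \<eta>2 q - Y \<eta>' q\<bar> \<le> \<bar>Y \<eta>2 l - Y \<eta>' l\<bar> * exp (B / \<eta>'\<^sup>2 * (q - l))"
            proof (rule ode_dependence[where F = "F \<eta>'"])
              fix s assume s: "l < s" "s < q"
              have "F \<eta>2 s (Y \<eta>2 s) = F \<eta>' s (Y \<eta>2 s)"
                using Y2[of s] \<eta>2 s by (simp add: F_def max_def)
              then show "(Y \<eta>2 has_real_derivative F \<eta>' s (Y \<eta>2 s)) (at s)"
                using Yd'[OF \<eta>2(1), of s] s q t by auto
              show "(Y \<eta>' has_real_derivative F \<eta>' s (Y \<eta>' s)) (at s)"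
                using Yd'[of \<eta>' s] s q t \<eta>' by auto
              show "\<bar>F \<eta>' s (Y \<eta>2 s) - F \<eta>' s (Y \<eta>' s)\<bar> \<le> B / \<eta>'\<^sup>2 * \<bar>Y \<eta>2 s - Y \<eta>' s\<bar>"
                using lip[of \<eta>' s] s q t \<eta>' by auto
            qed (use q t \<eta>2 \<eta>' in \<open>auto intro!: continuous_on_subset[OF Yc]\<close>)
            then show ?thesis using Yl[of \<eta>2] Yl[of \<eta>'] Y2[of q] \<eta>2 \<eta>' q by simp
          qed
          have "Y \<eta>' t \<ge> \<eta>'"
          proof (rule ccontr)
            assume "\<not> \<eta>' \<le> Y \<eta>' t"
            then have "eventually (\<lambda>s. Y \<eta>' s < \<eta>') (at t within {l..r})"
              using Yc[OF \<eta>'(1)] t by (intro order_tendstoD) (auto simp: continuous_on)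
            then obtain d' where d': "d' > 0" "\<And>s. s \<in> {l..r} \<Longrightarrow> s \<noteq> t \<Longrightarrow> dist s t < d' \<Longrightarrow> Y \<eta>' s < \<eta>'"
              unfolding eventually_at by auto
            define s where "s = max l (t - d'/2)"
            have "s \<in> {l..<t}" "dist s t < d'" using lt d' by (auto simp: s_def dist_real_def)
            then show False using d'(2)[of s] Yge[of s] t by auto
          qed
          then have "good \<eta>' t" using Yge \<eta>' unfolding good_def
            by (metis atLeastAtMost_iff atLeastLessThan_iff order_le_less)
          then show False using nok by (auto simp: ok_def)
        qed
      qed
      then show ?thesis using v0[OF nok] by (simp add: continuous_within)
    qed
  qed
  have "v q \<ge> 0" if "q \<in> {l..r}" for q using ok_pos[OF _ that] v0[of q] by force
  moreover have "ok q" if "v q > 0" for q using v0[of q] that by force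
  moreover have "v q' = 0" if "v q = 0" "q \<in> {l..r}" "q' \<in> {q..r}" for q q'
    using ok_pos[of q] ok_down[of q' q] v0[of q'] that by force
  ultimately have "traj c e v"
    unfolding downward_trajectory_def using cont v_l deriv by blast
  then show ?thesis by blast
qed

end

text \<open>Counterpart of \<open>gronwall_nonpos\<close> for a positive start. If
  \<open>d b < d a\<close>, choose a level \<open>e > 0\<close> strictly between \<open>d b\<close>
  and \<open>d a\<close>; just after the last point with \<open>d \<ge> e\<close> the function is
  still positive, hence nondecreasing, and cannot drop below \<open>e\<close>.\<close>

lemma nondecreasing_while_positive:
  fixes d :: "real \<Rightarrow> real"
  assumes "a \<le> b" and cont: "continuous_on {a..b} d" and "d a > 0"
    and D: "\<And>q. a < q \<Longrightarrow> q < b \<Longrightarrow> d q > 0 \<Longrightarrow> \<exists>D\<ge>0. (d has_real_derivative D) (at q)"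
  shows "d a \<le> d b"
proof (rule ccontr)
  assume "\<not> d a \<le> d b"
  define e where "e = max (d b) 0 / 2 + d a / 2"
  have e: "0 < e" "e < d a" "d b < e" using \<open>\<not> d a \<le> d b\<close> \<open>d a > 0\<close> by (auto simp: e_def max_def)
  have "a < b" using \<open>\<not> d a \<le> d b\<close> \<open>a \<le> b\<close> by (cases "a = b") auto
  moreover have "continuous_on {a..b} (\<lambda>q. e - d q)" by (intro continuous_intros cont)
  ultimately obtain s where s: "a \<le> s" "s < b" "e - d s = 0"
    and pos: "\<And>q. s < q \<Longrightarrow> q \<le> b \<Longrightarrow> e - d q > 0"
    using last_nonpos[of a b "\<lambda>q. e - d q"] e by auto
  have "(d \<longlongrightarrow> d s) (at s within {a..b})" using cont s by (auto simp: continuous_on)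
  then have "eventually (\<lambda>q. d q > 0) (at s within {a..b})"
    by (rule order_tendstoD) (use s e in auto)
  then obtain \<delta> where \<delta>: "\<delta> > 0" "\<And>q. q \<in> {a..b} \<Longrightarrow> q \<noteq> s \<Longrightarrow> dist q s < \<delta> \<Longrightarrow> d q > 0"
    unfolding eventually_at by auto
  define t where "t = min b (s + \<delta>/2)"
  have t: "s < t" "t \<le> b" using s \<delta> by (auto simp: t_def)
  have "d s \<le> d t"
  proof (rule DERIV_nonneg_imp_increasing_open[where f = d])
    fix x assume x: "s < x" "x < t"
    then have "d x > 0" using \<delta>(2)[of x] s t by (auto simp: t_def dist_real_def)
    then show "\<exists>y. (d has_real_derivative y) (at x) \<and> y \<ge> 0" using D[of x] x s t by auto
  qed (use s t in \<open>auto intro: continuous_on_subset[OF cont]\<close>)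
  then show False using pos[of t] s t by simp
qed

section \<open>Order, growth and extinction of trajectories\<close>

context monostable
begin

text \<open>If \<open>v\<close> exceeds \<open>w\<close> at \<open>q\<close>, consider the last
  crossing before \<open>q\<close>. Because \<open>0\<close> is absorbing and
  \<open>v q > 0\<close>, the crossing happens at positive height; just after it both curves solve a
  common truncated equation with the same value, so they cannot separate. Equal starting values give
  uniqueness.\<close>

lemma traj_mono:
  assumes v: "traj c e1 v" and w: "traj c e2 w" and "e1 \<le> e2" and q: "q \<in> {l..r}"
  shows "v q \<le> w q"
proof (rule ccontr)
  assume "\<not> v q \<le> w q"
  then have d: "v q - w q > 0" by simp
  have lq: "l < q" using d trajD(2)[OF v] trajD(2)[OF w] assms(3) q by (cases "l = q") auto
  have "continuous_on {l..q} (\<lambda>s. v s - w s)"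
    using q by (intro continuous_intros continuous_on_subset[OF trajD(1)[OF v]]
      continuous_on_subset[OF trajD(1)[OF w]]) auto
  from last_nonpos[OF lq this _ d] obtain s where
    s: "l \<le> s" "s < q" "v s - w s = 0" and pos: "\<And>t. s < t \<Longrightarrow> t \<le> q \<Longrightarrow> v t - w t > 0"
    using trajD(2)[OF v] trajD(2)[OF w] assms(3) by auto
  have vq: "v q > 0" using d trajD(3)[OF w q] by simp
  have v_pos: "v t > 0" if "t \<in> {l..q}" for t
    using trajD(6)[OF v _ _ _ vq] that q by auto
  define \<eta> where "\<eta> = w s / 2"
  have \<eta>: "\<eta> > 0" using v_pos[of s] s by (auto simp: \<eta>_def)
  have "(w \<longlongrightarrow> w s) (at s within {l..r})"
    using trajD(1)[OF w] s q by (auto simp: continuous_on)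
  then have "eventually (\<lambda>t. w t > \<eta>) (at s within {l..r})"
    by (rule order_tendstoD) (use \<eta> in \<open>simp add: \<eta>_def\<close>)
  then obtain \<delta> where \<delta>: "\<delta> > 0" "\<And>t. t \<in> {l..r} \<Longrightarrow> t \<noteq> s \<Longrightarrow> dist t s < \<delta> \<Longrightarrow> w t > \<eta>"
    unfolding eventually_at by auto
  define t where "t = min q (s + \<delta>/2)"
  have t: "s < t" "t \<le> q" using \<delta> s by (auto simp: t_def)
  have w_ge: "w x > \<eta>" if "s < x" "x \<le> t" for x
    using \<delta>(2)[of x] that s q by (auto simp: t_def dist_real_def)
  have v_ge: "v x > \<eta>" if "s < x" "x \<le> t" for x
    using w_ge[OF that] pos[of x] that t by auto
  define F where "F x y = c - f x / max y \<eta>" for x y :: real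
  have "\<bar>v t - w t\<bar> \<le> \<bar>v s - w s\<bar> * exp (K * (r - l) / \<eta>\<^sup>2 * (t - s))"
  proof (rule ode_dependence[where F = F])
    fix x assume x: "s < x" "x < t"
    have "F x (v x) = c - f x / v x" "F x (w x) = c - f x / w x"
      using v_ge[of x] w_ge[of x] x by (auto simp: F_def max_def)
    moreover have "l < x" "x < r" "v x > 0" "w x > 0" using v_ge[of x] w_ge[of x] x \<eta> s t q by auto
    ultimately show "(v has_real_derivative F x (v x)) (at x)" "(w has_real_derivative F x (w x)) (at x)"
      using trajD(5)[OF v, of x] trajD(5)[OF w, of x] by auto
    show "\<bar>F x (v x) - F x (w x)\<bar> \<le> K * (r - l) / \<eta>\<^sup>2 * \<bar>v x - w x\<bar>"
      unfolding F_def using x s t q by (intro cutoff_lipschitz \<eta> f_abs_le) auto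
  qed (use s t q in \<open>auto intro: continuous_on_subset[OF trajD(1)[OF v]] continuous_on_subset[OF trajD(1)[OF w]]\<close>)
  then show False using pos[of t] t s by simp
qed

lemma traj_growth:
  assumes v: "traj c e v" and "l \<le> a" "a \<le> b" "b \<le> r" and "c \<ge> 0"
  shows "v b \<le> v a + c * (b - a)"
proof -
  have "v b - v a - c * (b - a) \<le> 0"
  proof (rule gronwall_nonpos[where C = 0 and a = a and d = "\<lambda>x. v x - v a - c * (x - a)"])
    show "continuous_on {a..b} (\<lambda>x. v x - v a - c * (x - a))"
      using assms by (intro continuous_intros continuous_on_subset[OF trajD(1)[OF v]]) auto
  next
    fix x assume x: "a < x" "x < b" and pos: "v x - v a - c * (x - a) > 0"
    have "v a \<ge> 0" "c * (x - a) \<ge> 0" using trajD(3)[OF v] assms x by auto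
    then have vx: "v x > 0" using pos by linarith
    have "((\<lambda>x. v x - v a - c * (x - a)) has_real_derivative - (f x / v x)) (at x)"
      using trajD(5)[OF v _ _ vx] x assms by (auto intro!: derivative_eq_intros)
    moreover have "f x / v x \<ge> 0" using f_nonneg[of x] vx x assms by auto
    ultimately show "\<exists>D. ((\<lambda>x. v x - v a - c * (x - a)) has_real_derivative D) (at x)
        \<and> D \<le> 0 * (v x - v a - c * (x - a))" by auto
  qed (use assms in auto)
  then show ?thesis by simp
qed

text \<open>The numerical condition is \<open>\<eta> < (m / \<eta> - c) * d\<close> multiplied by
  \<open>\<eta>\<close>. It forces \<open>c * \<eta> < m\<close>, so a curve entering below
  \<open>\<eta>\<close> cannot rise above it; there its slope is at most
  \<open>c - m / \<eta>\<close>, and over the length \<open>d\<close> this uses up the whole height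
  \<open>\<eta>\<close>.\<close>

lemma traj_dies:
  assumes v: "traj c e v" and q: "l \<le> q" "q + d \<le> r" and "d > 0" "c \<ge> 0"
    and m: "\<And>x. q \<le> x \<Longrightarrow> x \<le> q + d \<Longrightarrow> f x \<ge> m"
    and "\<eta> > 0" "v q \<le> \<eta>" "\<eta> * (\<eta> + c * d) < m * d"
  shows "v (q + d) = 0"
proof (rule ccontr)
  assume "v (q + d) \<noteq> 0"
  then have vd: "v (q + d) > 0" using trajD(3)[OF v, of "q + d"] q \<open>d > 0\<close> by auto
  have v_pos: "v x > 0" if "q \<le> x" "x \<le> q + d" for x
    using trajD(6)[OF v _ _ _ vd, of x] that q by auto
  have v_deriv: "(v has_real_derivative c - f x / v x) (at x)" if "q < x" "x < q + d" for x
    using trajD(5)[OF v, of x] v_pos[of x] that q by auto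
  have v_cont: "continuous_on {q..b} v" if "b \<le> q + d" for b
    using q that by (auto intro: continuous_on_subset[OF trajD(1)[OF v]])
  have \<eta>2: "\<eta> * \<eta> + c * \<eta> * d < m * d" using assms(9) by (simp add: algebra_simps)
  have "\<eta> * c * d < m * d" using \<eta>2 \<open>\<eta> > 0\<close> by (smt (verit) mult_pos_pos mult.commute)
  then have cm: "c * \<eta> < m" using \<open>d > 0\<close> by (simp add: mult.commute)
  have small: "v b \<le> \<eta>" if b: "q \<le> b" "b \<le> q + d" for b
  proof -
    have "v b - \<eta> \<le> 0"
    proof (rule gronwall_nonpos[where C = "c / \<eta>" and a = q and d = "\<lambda>x. v x - \<eta>"])
      fix x assume x: "q < x" "x < b" and pos: "v x - \<eta> > 0"
      have vx: "v x > 0" using v_pos[of x] x b by auto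
      have "c - f x / v x \<le> c - m / v x"
        using m[of x] x b vx by (intro diff_left_mono divide_right_mono) auto
      also have "\<dots> = (c * v x - m) / v x" using vx by (simp add: field_simps)
      also have "\<dots> \<le> (c * (v x - \<eta>)) / v x"
        using cm vx by (intro divide_right_mono) (auto simp: algebra_simps)
      also have "\<dots> \<le> (c * (v x - \<eta>)) / \<eta>"
        using pos \<open>\<eta> > 0\<close> \<open>c \<ge> 0\<close> vx by (intro divide_left_mono) auto
      finally have "c - f x / v x \<le> c / \<eta> * (v x - \<eta>)" by simp
      moreover have "((\<lambda>x. v x - \<eta>) has_real_derivative c - f x / v x) (at x)"
        using v_deriv[of x] x b by (auto intro!: derivative_eq_intros)
      ultimately show "\<exists>D. ((\<lambda>x. v x - \<eta>) has_real_derivative D) (at x) \<and> D \<le> c / \<eta> * (v x - \<eta>)"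
        by blast
    qed (use b assms v_cont in \<open>auto intro!: continuous_intros\<close>)
    then show ?thesis by simp
  qed
  let ?g = "\<lambda>x. v x + (m / \<eta> - c) * x"
  have "?g (q + d) \<le> ?g q"
  proof (rule DERIV_nonpos_imp_decreasing_open[where f = ?g])
    fix x assume x: "q < x" "x < q + d"
    have vx: "v x > 0" using v_pos[of x] x by auto
    have "m > 0" using cm \<open>c \<ge> 0\<close> \<open>\<eta> > 0\<close> by (smt (verit) mult_nonneg_nonneg)
    then have "m / \<eta> \<le> m / v x" using small[of x] x vx \<open>\<eta> > 0\<close> by (intro divide_left_mono) auto
    also have "\<dots> \<le> f x / v x" using m[of x] x vx by (intro divide_right_mono) auto
    finally have "c - f x / v x + (m / \<eta> - c) \<le> 0" by simp
    moreover have "(?g has_real_derivative c - f x / v x + (m / \<eta> - c)) (at x)"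
      using v_deriv[OF x] by (auto intro!: derivative_eq_intros)
    ultimately show "\<exists>y. (?g has_real_derivative y) (at x) \<and> y \<le> 0" by blast
  qed (use v_cont \<open>d > 0\<close> in \<open>auto intro!: continuous_intros\<close>)
  then have "v (q + d) \<le> v q - (m / \<eta> - c) * d" by (simp add: distrib_left)
  with \<open>v q \<le> \<eta>\<close> have "v (q + d) \<le> \<eta> - (m / \<eta> - c) * d" by simp
  moreover have "\<eta> < (m / \<eta> - c) * d"
    using \<eta>2 \<open>\<eta> > 0\<close> by (simp add: field_simps)
  ultimately show False using vd by simp
qed

section \<open>Dependence on the starting value and its limit\<close>

definition traj_from where "traj_from c e = (SOME v. traj c e v)"

lemma traj_from: "e > 0 \<Longrightarrow> traj c e (traj_from c e)"
  unfolding traj_from_def by (rule someI_ex[OF traj_exists])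

lemma traj_from_unique:
  assumes "traj c e v" "e > 0" "q \<in> {l..r}"
  shows "v q = traj_from c e q"
  using traj_mono[OF assms(1) traj_from[OF assms(2)] order_refl assms(3)]
    traj_mono[OF traj_from[OF assms(2)] assms(1) order_refl assms(3)] by simp

text \<open>Existence and uniqueness of trajectories together make the definite description in
  \<open>p_eps\<close> denote.\<close>

lemma p_eps_eq:
  assumes "e > 0" "q \<in> {l..r}"
  shows "p_eps f l r c e q = - traj_from c e q"
  unfolding p_eps_def
proof (rule the_equality)
  have "trajectory f l r c e (\<lambda>q. - traj_from c e q)"
    using traj_from[OF assms(1)] by (simp add: trajectory_iff_downward)
  then show "\<exists>p. trajectory f l r c e p \<and> p q = - traj_from c e q" by blast
next
  fix y assume "\<exists>p. trajectory f l r c e p \<and> p q = y"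
  then show "y = - traj_from c e q"
    using traj_from_unique[OF _ assms] by (auto simp: trajectory_iff_downward)
qed

text \<open>Trajectories are monotone in \<open>e\<close>, so this infimum is the limit as
  \<open>e\<close> decreases to \<open>0\<close>. In this form any lower bound that is uniform in
  \<open>e\<close> passes directly to the limit.\<close>

definition traj_limit where "traj_limit c q = (INF e\<in>{0<..}. traj_from c e q)"

lemma traj_from_nonneg: "e > 0 \<Longrightarrow> q \<in> {l..r} \<Longrightarrow> traj_from c e q \<ge> 0"
  using trajD(3)[OF traj_from] by auto

lemma traj_from_bdd: "q \<in> {l..r} \<Longrightarrow> bdd_below ((\<lambda>e. traj_from c e q) ` {0<..})"
  using traj_from_nonneg by (auto simp: bdd_below_def intro!: exI[of _ 0])

lemma traj_limit_le: "e > 0 \<Longrightarrow> q \<in> {l..r} \<Longrightarrow> traj_limit c q \<le> traj_from c e q"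
  unfolding traj_limit_def using traj_from_bdd by (intro cINF_lower) auto

lemma traj_from_mono: "0 < e1 \<Longrightarrow> e1 \<le> e2 \<Longrightarrow> q \<in> {l..r} \<Longrightarrow> traj_from c e1 q \<le> traj_from c e2 q"
  using traj_mono[OF traj_from traj_from] by auto

lemma traj_from_tendsto:
  assumes q: "q \<in> {l..r}"
  shows "((\<lambda>e. traj_from c e q) \<longlongrightarrow> traj_limit c q) (at_right 0)"
proof (rule order_tendstoI)
  fix a assume "a < traj_limit c q"
  then show "eventually (\<lambda>e. a < traj_from c e q) (at_right 0)"
    using traj_limit_le[OF _ q] by (auto simp: eventually_at_right_field intro!: exI[of _ 1] intro: less_le_trans)
next
  fix a assume "traj_limit c q < a"
  then obtain e0 where e0: "e0 > 0" "traj_from c e0 q < a"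
    unfolding traj_limit_def using traj_from_bdd[OF q] by (subst (asm) cINF_less_iff) auto
  then show "eventually (\<lambda>e. traj_from c e q < a) (at_right 0)"
    using traj_from_mono[OF _ less_imp_le q, of _ e0] unfolding eventually_at_right_field
    by (intro exI[of _ e0]) (auto intro: le_less_trans)
qed

lemma p_lim_eq:
  assumes q: "q \<in> {l..r}"
  shows "p_lim f l r c q = - traj_limit c q"
proof -
  have "((\<lambda>e. - traj_from c e q) \<longlongrightarrow> - traj_limit c q) (at_right 0)" by (intro tendsto_intros traj_from_tendsto q)
  then have "((\<lambda>e. p_eps f l r c e q) \<longlongrightarrow> - traj_limit c q) (at_right 0)"
    by (rule Lim_transform_eventually)
      (use q in \<open>auto simp: eventually_at_right_field p_eps_eq intro!: exI[of _ 1]\<close>)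
  then show ?thesis unfolding p_lim_def by (intro tendsto_Lim) auto
qed

lemma traj_limit_approx:
  assumes q: "q \<in> {l..r}" and "traj_limit c q < a"
  obtains e0 where "e0 > 0" "\<And>e. 0 < e \<Longrightarrow> e \<le> e0 \<Longrightarrow> traj_from c e q < a"
proof -
  obtain e0 where e0: "e0 > 0" "traj_from c e0 q < a"
    using assms(2) unfolding traj_limit_def using traj_from_bdd[OF q] by (subst (asm) cINF_less_iff) auto
  then show thesis using traj_from_mono[OF _ _ q, of _ e0] by (intro that[of e0]) (auto intro: le_less_trans)
qed

section \<open>Admissible speeds and the critical speed\<close>

definition speeds where "speeds = {c. c > 0 \<and> traj_limit c r > 0}"

lemma critical_speed_eq: "critical_speed f l r = Inf speeds"
  unfolding critical_speed_def speeds_def using l_less_r by (simp add: p_lim_eq)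

text \<open>Above the ray \<open>v = q - l\<close> one has \<open>f / v \<le> K\<close>, so at speed
  \<open>K + 1\<close> the slope is at least \<open>1\<close>. Every trajectory starts above the ray
  and stays there, whatever \<open>e > 0\<close> is. Hence the infimum defining the critical speed
  is over a nonempty set.\<close>

lemma speeds_nonempty: "K + 1 \<in> speeds"
proof -
  have ge: "traj_from (K + 1) e r \<ge> r - l" if e: "e > 0" for e
  proof -
    note T = traj_from[OF e, of "K + 1"]
    have "traj_from (K + 1) e l - (l - l) \<le> traj_from (K + 1) e r - (r - l)"
    proof (rule nondecreasing_while_positive[where d = "\<lambda>x. traj_from (K + 1) e x - (x - l)"])
      show "continuous_on {l..r} (\<lambda>x. traj_from (K + 1) e x - (x - l))"
        by (intro continuous_intros trajD(1)[OF T])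
    next
      fix q assume q: "l < q" "q < r" "traj_from (K + 1) e q - (q - l) > 0"
      then have v: "traj_from (K + 1) e q > q - l" by simp
      then have vp: "traj_from (K + 1) e q > 0" using q by linarith
      have "K * (q - l) \<le> K * traj_from (K + 1) e q" using v K_nonneg by (intro mult_left_mono) auto
      then have "f q / traj_from (K + 1) e q \<le> K"
        using f_bound[of q] q vp by (simp add: divide_le_eq)
      moreover have "((\<lambda>x. traj_from (K + 1) e x - (x - l)) has_real_derivative (K + 1 - f q / traj_from (K + 1) e q) - 1) (at q)"
        using trajD(5)[OF T q(1,2) vp] by (auto intro!: derivative_eq_intros)
      ultimately show "\<exists>D\<ge>0. ((\<lambda>x. traj_from (K + 1) e x - (x - l)) has_real_derivative D) (at q)"
        by (intro exI[of _ "K + 1 - f q / traj_from (K + 1) e q - 1"]) auto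
    qed (use l_less_r trajD(2)[OF T] e in auto)
    then show ?thesis using trajD(2)[OF T] e by simp
  qed
  then have "traj_limit (K + 1) r \<ge> r - l"
    unfolding traj_limit_def by (intro cINF_greatest) auto
  then show ?thesis using l_less_r K_nonneg by (simp add: speeds_def)
qed

lemma traj_dies_threshold:
  assumes "m > 0" "d > 0" "c \<ge> 0"
  obtains \<eta> where "\<eta> > 0" "\<eta> * (\<eta> + c * d) < m * (d::real)"
proof -
  \<comment> \<open>The entry \<open>1\<close> replaces the quadratic left side by
    \<open>\<eta> * (1 + c * d)\<close>; the other entry makes that at most
    \<open>m * d / 2\<close>.\<close>
  define \<eta> where "\<eta> = min 1 (m * d / (2 * (1 + c * d)))"
  have cd: "c * d \<ge> 0" "m * d > 0" using assms by auto
  then have \<eta>: "\<eta> > 0" "\<eta> \<le> 1" by (auto simp: \<eta>_def)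
  have "\<eta> * (\<eta> + c * d) \<le> \<eta> * (1 + c * d)" using \<eta> by (intro mult_left_mono) auto
  also have "\<dots> \<le> m * d / (2 * (1 + c * d)) * (1 + c * d)"
    using cd by (intro mult_right_mono) (auto simp: \<eta>_def)
  also have "\<dots> = m * d / 2" using cd by (simp add: field_simps)
  finally show thesis using \<eta> cd by (intro that[of \<eta>]) auto
qed

lemma f_min:
  assumes "l < a" "a \<le> b" "b < r"
  obtains m where "m > 0" "\<And>x. a \<le> x \<Longrightarrow> x \<le> b \<Longrightarrow> f x \<ge> m"
proof -
  have "continuous_on {a..b} f" using assms by (auto intro: continuous_on_subset[OF f_cont])
  then obtain x where x: "x \<in> {a..b}" "\<And>y. y \<in> {a..b} \<Longrightarrow> f x \<le> f y"
    using continuous_attains_inf[of "{a..b}" f] assms by auto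
  show thesis using x f_pos[of x] assms by (intro that[of "f x"]) auto
qed

lemma traj_from_initial_growth: "e > 0 \<Longrightarrow> c \<ge> 0 \<Longrightarrow> q \<in> {l..r} \<Longrightarrow> traj_from c e q \<le> e + c * (q - l)"
  using traj_growth[OF traj_from, of e l q c] trajD(2)[OF traj_from, of e c] by auto

text \<open>At small speed a trajectory starting at \<open>\<eta> / 2\<close> has gained at most
  another \<open>\<eta> / 2\<close> at the midpoint, and then dies on the following quarter of the
  interval. Requiring \<open>c0 \<le> 1\<close> lets the threshold \<open>\<eta>\<close> for speed
  \<open>1\<close> serve all slower speeds.\<close>

lemma critical_speed_pos: "critical_speed f l r > 0"
proof -
  define q where "q = (l + r) / 2"
  define d where "d = (r - l) / 4"
  have qd: "l < q" "q \<le> q + d" "q + d < r" "d > 0" using l_less_r by (auto simp: q_def d_def field_simps)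
  obtain m where m: "m > 0" "\<And>x. q \<le> x \<Longrightarrow> x \<le> q + d \<Longrightarrow> f x \<ge> m"
    using f_min[OF qd(1-3)] by blast
  obtain \<eta> where \<eta>: "\<eta> > 0" "\<eta> * (\<eta> + 1 * d) < m * d"
    using traj_dies_threshold[OF m(1) qd(4), of 1] by auto
  define c0 where "c0 = min 1 (\<eta> / (2 * (q - l)))"
  have c0: "c0 > 0" using \<eta> qd by (auto simp: c0_def)
  have "c \<ge> c0" if c: "c \<in> speeds" for c
  proof (rule ccontr)
    assume "\<not> c0 \<le> c"
    then have cc: "0 < c" "c < c0" using c by (auto simp: speeds_def)
    note T = traj_from[of "\<eta>/2" c, OF half_gt_zero[OF \<eta>(1)]]
    have "c * (q - l) \<le> \<eta> / (2 * (q - l)) * (q - l)"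
      using cc qd by (intro mult_right_mono) (auto simp: c0_def)
    also have "\<dots> = \<eta> / 2" using qd(1) by (simp add: field_simps)
    finally have "traj_from c (\<eta>/2) q \<le> \<eta>" using traj_from_initial_growth[of "\<eta>/2" c q] \<eta> cc qd by auto
    moreover have "\<eta> * (\<eta> + c * d) < m * d"
    proof -
      have "c * d \<le> 1 * d" using cc qd by (intro mult_right_mono) (auto simp: c0_def)
      then have "\<eta> * (\<eta> + c * d) \<le> \<eta> * (\<eta> + 1 * d)" using \<eta> by (intro mult_left_mono) auto
      then show ?thesis using \<eta> by linarith
    qed
    ultimately have "traj_from c (\<eta>/2) (q + d) = 0"
      using traj_dies[OF T, of q d m \<eta>] qd cc m \<eta> by auto
    moreover have "traj_from c (\<eta>/2) r > 0" using c traj_limit_le[of "\<eta>/2" r c] \<eta> l_less_r by (auto simp: speeds_def)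
    ultimately show False using trajD(6)[OF T, of "q + d" r] qd by auto
  qed
  then have "Inf speeds \<ge> c0" using speeds_nonempty by (intro cInf_greatest) auto
  then show ?thesis using c0 by (simp add: critical_speed_eq)
qed

lemma speeds_below:
  assumes "critical_speed f l r < c"
  obtains c' where "c' \<in> speeds" "c' < c"
proof -
  have "speeds \<noteq> {}" using speeds_nonempty by blast
  from cInf_lessD[OF this, of c] assms obtain c' where "c' \<in> speeds" "c' < c"
    by (auto simp: critical_speed_eq)
  then show thesis by (rule that)
qed

text \<open>Such a \<open>c\<close> is not admissible, so the infimum over \<open>e\<close> of the
  values at \<open>r\<close> is not positive. This gives values below any
  \<open>\<sigma> > 0\<close>, without claiming that a trajectory vanishes at or before
  \<open>r\<close>.\<close>

lemma subcritical_traj: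
  assumes "0 < c" "c < critical_speed f l r" "\<sigma> > 0"
  obtains e v where "e > 0" "traj c e v" "v r < \<sigma>"
proof -
  have "bdd_below speeds" by (auto simp: speeds_def bdd_below_def intro!: exI[of _ 0])
  then have "c \<notin> speeds" using cInf_lower[of c speeds] assms by (auto simp: critical_speed_eq)
  then have "traj_limit c r < \<sigma>" using assms(1,3) by (auto simp: speeds_def)
  moreover have "r \<in> {l..r}" using l_less_r by simp
  ultimately obtain e where "e > 0" "traj_from c e r < \<sigma>"
    using traj_limit_approx[of r c \<sigma>] by (metis order_refl)
  then show thesis using that[OF _ traj_from] by blast
qed

lemma supercritical_traj:
  assumes c: "c \<in> speeds" and e: "e > 0"
  obtains v where "traj c e v" "\<And>q. q \<in> {l..r} \<Longrightarrow> v q > 0"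
proof -
  have "traj_from c e r > 0" using traj_limit_le[OF e, of r c] c l_less_r by (auto simp: speeds_def)
  then show thesis using trajD(6)[OF traj_from[OF e]] by (intro that[OF traj_from[OF e]]) auto
qed

text \<open>All trajectories end above \<open>L\<close> at \<open>r\<close>. Near \<open>r\<close>
  bounded growth, read backwards, keeps them above \<open>L / 2\<close>; farther left a value below
  \<open>\<eta>\<close> would lead to extinction before \<open>r\<close>. The bound is independent
  of \<open>e\<close>, so the truncated field for \<open>\<eta>\<close> serves the whole
  family.\<close>

lemma traj_from_lower_bound:
  assumes c: "c \<in> speeds" and q0: "l < q0" "q0 < r"
  obtains \<eta> where "\<eta> > 0" "\<And>e q. e > 0 \<Longrightarrow> q0 \<le> q \<Longrightarrow> q \<le> r \<Longrightarrow> traj_from c e q \<ge> \<eta>"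
proof -
  define L where "L = traj_limit c r"
  have L: "L > 0" "c > 0" using c by (auto simp: L_def speeds_def)
  have VL: "traj_from c e r \<ge> L" if "e > 0" for e using traj_limit_le[OF that, of r c] l_less_r by (auto simp: L_def)
  \<comment> \<open>Growth over a length \<open>2 * d\<close> is at most \<open>L / 2\<close>. To
    the left of \<open>r - 2 * d\<close> a stretch of length \<open>d\<close> ends before
    \<open>r - d\<close>, hence away from the zero of \<open>f\<close> at \<open>r\<close>.\<close>
  define d where "d = min (L / (2 * c)) ((r - q0) / 2) / 2"
  have "2 * d \<le> L / (2 * c)" "2 * d \<le> (r - q0) / 2" "d > 0"
    using L q0 min.cobounded1[of "L / (2 * c)" "(r - q0) / 2"] min.cobounded2[of "L / (2 * c)" "(r - q0) / 2"]
    unfolding d_def by simp_all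
  moreover from this(1) have "c * (2 * d) \<le> L / 2" using L by (simp add: field_simps)
  ultimately have d: "d > 0" "q0 < r - 2 * d" "c * (2 * d) \<le> L / 2" using q0 by auto
  obtain m where m: "m > 0" "\<And>x. q0 \<le> x \<Longrightarrow> x \<le> r - d \<Longrightarrow> f x \<ge> m"
    using f_min[of q0 "r - d"] q0 d by auto
  obtain \<eta> where \<eta>: "\<eta> > 0" "\<eta> * (\<eta> + c * d) < m * d"
    using traj_dies_threshold[OF m(1) d(1), of c] L by auto
  have "traj_from c e q \<ge> min \<eta> (L/2)" if e: "e > 0" and q: "q0 \<le> q" "q \<le> r" for e q
  proof (cases "q \<le> r - 2 * d")
    case True
    show ?thesis
    proof (rule ccontr)
      assume "\<not> min \<eta> (L/2) \<le> traj_from c e q"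
      then have "traj_from c e (q + d) = 0 \<or> traj_from c e q > \<eta>"
        using traj_dies[OF traj_from[OF e], of q d c m \<eta>] True q q0 d m \<eta> L by fastforce
      then have "traj_from c e (q + d) = 0" using \<open>\<not> min \<eta> (L/2) \<le> traj_from c e q\<close> by auto
      then show False using trajD(6)[OF traj_from[OF e], of "q + d" r c] VL[OF e] L True q q0 d by auto
    qed
  next
    case False
    then have "c * (r - q) \<le> c * (2 * d)" using L by (intro mult_left_mono) auto
    then have "c * (r - q) \<le> L/2" using d by linarith
    moreover have "traj_from c e r \<le> traj_from c e q + c * (r - q)"
      using traj_growth[OF traj_from[OF e], of q r c] q q0 L by auto
    ultimately show ?thesis using VL[OF e] by linarith
  qed
  then show thesis using that[of "min \<eta> (L/2)"] \<eta> L by auto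
qed

text \<open>On \<open>{q0..r}\<close> the whole family solves one Lipschitz equation, truncated at
  the uniform lower bound. Let \<open>y\<close> be its solution starting from the limiting value at
  \<open>q0\<close>; continuous dependence sends the trajectories to \<open>y\<close> as
  \<open>e\<close> decreases to \<open>0\<close>, so the limit inherits the equation.
  Differentiating within \<open>{..r}\<close> covers interior points and the end point
  alike.\<close>

lemma limit_traj:
  assumes c: "c \<in> speeds"
  shows "\<And>q. l < q \<Longrightarrow> q \<le> r \<Longrightarrow> traj_limit c q > 0"
    and "\<And>q. l \<le> q \<Longrightarrow> q \<le> r \<Longrightarrow> traj_limit c q \<le> c * (q - l)"
    and "\<And>q. l < q \<Longrightarrow> q \<le> r \<Longrightarrow> (traj_limit c has_real_derivative c - f q / traj_limit c q) (at q within {..r})"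
proof -
  have cpos: "c > 0" using c by (simp add: speeds_def)
  show "traj_limit c q \<le> c * (q - l)" if "l \<le> q" "q \<le> r" for q
  proof (rule field_le_epsilon)
    fix e :: real assume "e > 0"
    then show "traj_limit c q \<le> c * (q - l) + e"
      using traj_limit_le[of e q c] traj_from_initial_growth[of e c q] cpos that by auto
  qed
  have main: "traj_limit c q > 0 \<and> (traj_limit c has_real_derivative c - f q / traj_limit c q) (at q within {..r})"
    if q: "l < q" "q \<le> r" for q
  proof -
    define q0 where "q0 = (l + q) / 2"
    have q0: "l < q0" "q0 < q" "q0 < r" using q by (auto simp: q0_def)
    obtain \<eta> where \<eta>: "\<eta> > 0" "\<And>e q. e > 0 \<Longrightarrow> q0 \<le> q \<Longrightarrow> q \<le> r \<Longrightarrow> traj_from c e q \<ge> \<eta>"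
      using traj_from_lower_bound[OF c q0(1,3)] by blast
    have traj_limit_ge: "traj_limit c x \<ge> \<eta>" if "q0 \<le> x" "x \<le> r" for x
      unfolding traj_limit_def using \<eta>(2) that by (intro cINF_greatest) auto
    define F where "F q y = c - f q / max y \<eta>" for q y :: real
    define L where "L = K * (r - l) / \<eta>\<^sup>2"
    have lip: "\<bar>F x y - F x z\<bar> \<le> L * \<bar>y - z\<bar>" if "x \<in> {q0..r}" for x y z
      unfolding F_def L_def using that q0 by (intro cutoff_lipschitz \<eta> f_abs_le) auto
    have "continuous_on ({q0..r} \<times> UNIV) (\<lambda>(q, y). F q y)"
      unfolding F_def case_prod_unfold using \<eta>(1) q0
      by (intro continuous_intros continuous_on_compose2[OF f_cont]) auto
    then obtain y where y0: "y q0 = traj_limit c q0"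
      and y: "\<And>x. x \<in> {q0..r} \<Longrightarrow> (y has_real_derivative F x (y x)) (at x within {q0..r})"
      using picard_lindelof_interval[of q0 r F L "traj_limit c q0"] lip q0 by auto
    have ycont: "continuous_on {q0..r} y"
      using y by (meson DERIV_continuous continuous_on_eq_continuous_within)
    have traj_limit_eq: "traj_limit c x = y x" if x: "q0 \<le> x" "x \<le> r" for x
    proof -
      have bound: "\<bar>traj_from c e x - y x\<bar> \<le> \<bar>traj_from c e q0 - y q0\<bar> * exp (L * (x - q0))" if e: "e > 0" for e
      proof (rule ode_dependence[where F = F])
        fix s assume s: "q0 < s" "s < x"
        have "traj_from c e s \<ge> \<eta>" using \<eta>(2)[OF e] s x by auto
        then show "(traj_from c e has_real_derivative F s (traj_from c e s)) (at s)"
          using trajD(5)[OF traj_from[OF e], of s c] s x q0 \<eta>(1) by (simp add: F_def max_def)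
        show "(y has_real_derivative F s (y s)) (at s)"
          using y[of s] s x at_within_Icc_at[of q0 s r] by auto
        show "\<bar>F s (traj_from c e s) - F s (y s)\<bar> \<le> L * \<bar>traj_from c e s - y s\<bar>" using lip s x by auto
      qed (use x q0 in \<open>auto intro: continuous_on_subset[OF trajD(1)[OF traj_from[OF e]]] continuous_on_subset[OF ycont]\<close>)
      have "((\<lambda>e. \<bar>traj_from c e x - y x\<bar>) \<longlongrightarrow> \<bar>traj_limit c x - y x\<bar>) (at_right 0)"
        using x q0 by (intro tendsto_intros traj_from_tendsto) auto
      moreover have "((\<lambda>e. \<bar>traj_from c e q0 - y q0\<bar> * exp (L * (x - q0))) \<longlongrightarrow>
          \<bar>traj_limit c q0 - y q0\<bar> * exp (L * (x - q0))) (at_right 0)"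
        using q0 by (intro tendsto_intros traj_from_tendsto) auto
      moreover have "eventually (\<lambda>e. \<bar>traj_from c e x - y x\<bar> \<le> \<bar>traj_from c e q0 - y q0\<bar> * exp (L * (x - q0))) (at_right 0)"
        using bound by (auto simp: eventually_at_right_field intro!: exI[of _ 1])
      ultimately have "\<bar>traj_limit c x - y x\<bar> \<le> \<bar>traj_limit c q0 - y q0\<bar> * exp (L * (x - q0))"
        by (intro tendsto_le[OF trivial_limit_at_right_real])
      then show ?thesis using y0 by simp
    qed
    have "F q (y q) = c - f q / traj_limit c q"
      using traj_limit_ge[of q] traj_limit_eq[of q] q q0 by (simp add: F_def max_def)
    then have "(y has_real_derivative c - f q / traj_limit c q) (at q within {q0..r})" using y[of q] q q0 by auto
    then have "(traj_limit c has_real_derivative c - f q / traj_limit c q) (at q within {q0..r})"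
      by (rule has_field_derivative_transform_within[where d = 1]) (use q q0 traj_limit_eq in auto)
    moreover have "at q within {q0..r} = at q within {..r}"
      by (rule at_within_nhd[where S = "{q0<..}"]) (use q0 in auto)
    ultimately show ?thesis using traj_limit_ge[of q] \<eta> q q0 by auto
  qed
  then show "traj_limit c q > 0" "(traj_limit c has_real_derivative c - f q / traj_limit c q) (at q within {..r})"
    if "l < q" "q \<le> r" for q using that by auto
qed

end

section \<open>Maximum principle and comparison\<close>

text \<open>
  The second space derivative is one-sided, which still suffices at a maximum; this admits glued
  profiles, whose second derivative jumps.
\<close>

definition parabolic_derivs ::
    "(real \<Rightarrow> real \<Rightarrow> real) \<Rightarrow> real \<Rightarrow> real \<Rightarrow> real \<Rightarrow> real \<Rightarrow> bool" where
  "parabolic_derivs z x t zt zxx \<longleftrightarrow>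
     (\<exists>zx. (\<forall>\<^sub>F y in nhds x. ((\<lambda>y. z y t) has_real_derivative zx y) (at y)) \<and>
       (zx has_real_derivative zxx) (at x within {x..}) \<and>
       ((\<lambda>s. z x s) has_real_derivative zt) (at t))"

lemma parabolic_derivs_diff:
  assumes "parabolic_derivs z x t zt zxx" "parabolic_derivs w x t wt wxx"
  shows "parabolic_derivs (\<lambda>x t. z x t - w x t) x t (zt - wt) (zxx - wxx)"
proof -
  obtain zx where z: "\<forall>\<^sub>F y in nhds x. ((\<lambda>y. z y t) has_real_derivative zx y) (at y)"
    "(zx has_real_derivative zxx) (at x within {x..})" "((\<lambda>s. z x s) has_real_derivative zt) (at t)"
    using assms(1) by (auto simp: parabolic_derivs_def)
  obtain wx where w: "\<forall>\<^sub>F y in nhds x. ((\<lambda>y. w y t) has_real_derivative wx y) (at y)"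
    "(wx has_real_derivative wxx) (at x within {x..})" "((\<lambda>s. w x s) has_real_derivative wt) (at t)"
    using assms(2) by (auto simp: parabolic_derivs_def)
  have "\<forall>\<^sub>F y in nhds x. ((\<lambda>y. z y t - w y t) has_real_derivative zx y - wx y) (at y)"
    using z(1) w(1) by eventually_elim (rule DERIV_diff)
  then show ?thesis
    unfolding parabolic_derivs_def using z(2,3) w(2,3)
    by (intro exI[of _ "\<lambda>y. zx y - wx y"] conjI DERIV_diff)
qed

lemma parabolic_derivsI:
  assumes "\<And>y. ((\<lambda>y. z y t) has_real_derivative zx y) (at y)"
    and "(zx has_real_derivative zxx) (at x within {x..})"
    and "((\<lambda>s. z x s) has_real_derivative zt) (at t)"
  shows "parabolic_derivs z x t zt zxx"
  using assms unfolding parabolic_derivs_def by (intro exI[of _ zx]) auto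

text \<open>At the maximum \<open>g' x = 0\<close>; a positive right derivative of \<open>g'\<close>
  would make \<open>g'\<close> positive just to the right and push \<open>g\<close> above its
  maximum.\<close>

lemma right_second_derivative_at_max:
  fixes g :: "real \<Rightarrow> real"
  assumes "e > 0" and g: "\<And>y. \<bar>y - x\<bar> < e \<Longrightarrow> (g has_real_derivative g' y) (at y)"
    and D: "(g' has_real_derivative D) (at x within {x..})"
    and max: "\<And>y. \<bar>y - x\<bar> < e \<Longrightarrow> g y \<le> g x"
  shows "D \<le> 0"
proof (rule ccontr)
  assume "\<not> D \<le> 0"
  then have "D > 0" by simp
  have g'x: "g' x = 0"
    using DERIV_local_max[OF g[of x] \<open>e > 0\<close>] max assms(1) by (auto simp: abs_minus_commute)
  obtain d where d: "d > 0" "\<And>h. h > 0 \<Longrightarrow> h < d \<Longrightarrow> g' x < g' (x + h)"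
    using has_real_derivative_pos_inc_right[OF D \<open>D > 0\<close>] by auto
  define y where "y = x + min d e / 2"
  have y: "x < y" "y < x + d" "y < x + e" using d(1) \<open>e > 0\<close> by (auto simp: y_def min_def)
  have "g x < g y"
  proof (rule DERIV_pos_imp_increasing_open[where f = g, OF y(1)])
    fix s assume s: "x < s" "s < y"
    then have "g' s > 0" using d(2)[of "s - x"] g'x y by auto
    then show "\<exists>D. (g has_real_derivative D) (at s) \<and> D > 0" using g[of s] s y by auto
  next
    show "continuous_on {x..y} g"
    proof (rule DERIV_atLeastAtMost_imp_continuous_on)
      show "\<exists>D. (g has_real_derivative D) (at s)" if "x \<le> s" "s \<le> y" for s
        using g[of s] that y by auto
    qed
  qed
  then show False using max[of y] y by simp
qed

text \<open>Initial and lateral boundary conditions are encoded in one requirement: a point of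
  \<open>G\<close> with \<open>z > 0\<close> is interior to \<open>G\<close>. This allows regions
  with moving boundaries. The differential inequality, too, is asked only where
  \<open>z > 0\<close>.\<close>

theorem maximum_principle:
  fixes z :: "real \<Rightarrow> real \<Rightarrow> real"
  assumes G: "closed G" "\<And>x t. (x, t) \<in> G \<Longrightarrow> t0 \<le> t"
    and cont: "continuous_on G (\<lambda>(x, t). z x t)"
    and B: "\<And>x t. (x, t) \<in> G \<Longrightarrow> z x t \<le> B"
    and "K \<ge> 0"
    and par: "\<And>x t. (x, t) \<in> G \<Longrightarrow> z x t > 0 \<Longrightarrow> (x, t) \<in> interior G \<and>
      (\<exists>zt zxx. parabolic_derivs z x t zt zxx \<and> zt \<le> zxx + K * z x t)"
    and xT: "(x, T) \<in> G"
  shows "z x T \<le> 0"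
proof (rule ccontr)
  assume "\<not> z x T \<le> 0"
  then have zpos: "z x T > 0" by simp
  have T: "t0 \<le> T" using G xT by auto
  \<comment> \<open>The rate \<open>K + 1\<close> exceeds \<open>K\<close>, so the weighted function
    has a strictly negative zero-order term, which yields the contradiction at the maximum.\<close>
  define E where "E t = exp (- (K + 1) * (t - t0))" for t
  have E: "E t > 0" for t by (simp add: E_def)
  have E1: "E t \<le> 1" if "t0 \<le> t" for t using that \<open>K \<ge> 0\<close> by (simp add: E_def mult_nonpos_nonneg)
  \<comment> \<open>Chosen so that the penalty at \<open>(x, T)\<close> takes away at most half of
    \<open>E T * z x T\<close>.\<close>
  define \<delta> where "\<delta> = E T * z x T / (2 * (x\<^sup>2 + 2 * (T - t0) + 1))"
  have den: "x\<^sup>2 + 2 * (T - t0) + 1 > 0" using T by (smt (verit) zero_le_power2)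
  have \<delta>: "\<delta> > 0" unfolding \<delta>_def using den E[of T] zpos by (intro divide_pos_pos mult_pos_pos) auto
  \<comment> \<open>The penalty \<open>y\<^sup>2 + 2 * (t - t0)\<close> solves the heat equation and forces a maximum to exist.\<close>
  define \<phi> where "\<phi> y t = E t * z y t - \<delta> * (y\<^sup>2 + 2 * (t - t0))" for y t
  have "\<delta> * (x\<^sup>2 + 2 * (T - t0)) \<le> \<delta> * (x\<^sup>2 + 2 * (T - t0) + 1)" using \<delta> by (intro mult_left_mono) auto
  also have "\<dots> = E T * z x T / 2"
  proof -
    have "a / (2 * b) * b = a / 2" if "b > 0" for a b :: real using that by simp
    from this[OF den] show ?thesis unfolding \<delta>_def .
  qed
  also have "\<dots> < E T * z x T" using E[of T] zpos by simp
  finally have \<phi>pos: "\<phi> x T > 0" by (simp add: \<phi>_def)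
  \<comment> \<open>Beyond \<open>R\<close> the penalty exceeds the bound \<open>B\<close>, so the
    penalised function is not positive there, and its maximum over a compact piece is its maximum
    over all of \<open>G\<close> up to time \<open>T\<close>.\<close>
  define R where "R = max \<bar>x\<bar> (B / \<delta> + 1)"
  have Bpos: "B > 0" using B[OF xT] zpos by simp
  then have "B / \<delta> > 0" using \<delta> by simp
  then have R: "R \<ge> 1" "R \<ge> B / \<delta>" "R \<ge> \<bar>x\<bar>"
    unfolding R_def by (simp_all add: max.coboundedI2)
  have BR: "B \<le> \<delta> * y\<^sup>2" if "\<bar>y\<bar> > R" for y
  proof -
    have "B / \<delta> \<le> 1 * R" using R by simp
    also have "\<dots> \<le> R * R" using R by (intro mult_right_mono) auto
    also have "\<dots> \<le> \<bar>y\<bar> * \<bar>y\<bar>" using that R by (intro mult_mono) auto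
    finally show ?thesis using \<delta> by (simp add: field_simps power2_eq_square)
  qed
  define C where "C = G \<inter> ({-R..R} \<times> {t0..T})"
  have "compact C" unfolding C_def by (intro closed_Int_compact G compact_Times compact_Icc)
  moreover have xC: "(x, T) \<in> C" using xT R T by (auto simp: C_def)
  moreover have "continuous_on C (\<lambda>p. \<phi> (fst p) (snd p))"
  proof -
    have "continuous_on C (\<lambda>p. z (fst p) (snd p))"
      using continuous_on_subset[OF cont, of C] by (auto simp: C_def case_prod_unfold)
    then show ?thesis unfolding \<phi>_def E_def by (intro continuous_intros)
  qed
  ultimately obtain p where p: "p \<in> C" "\<And>q. q \<in> C \<Longrightarrow> \<phi> (fst q) (snd q) \<le> \<phi> (fst p) (snd p)"
    using continuous_attains_sup[of C "\<lambda>p. \<phi> (fst p) (snd p)"] by blast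
  define x1 t1 where "x1 = fst p" and "t1 = snd p"
  have p_eq: "p = (x1, t1)" by (simp add: x1_def t1_def)
  have \<phi>1: "\<phi> x1 t1 > 0" using p(2)[OF xC] \<phi>pos by (simp add: p_eq)
  have t1: "t0 \<le> t1" "t1 \<le> T" and p_in: "(x1, t1) \<in> G" using p(1) by (auto simp: p_eq C_def)
  have max: "\<phi> y s \<le> \<phi> x1 t1" if "(y, s) \<in> G" "s \<le> T" for y s
  proof (cases "\<bar>y\<bar> \<le> R")
    case True
    then have "(y, s) \<in> C" using that G by (auto simp: C_def)
    then show ?thesis using p(2)[of "(y, s)"] by (simp add: p_eq)
  next
    case False
    have s: "t0 \<le> s" using that G by auto
    have "E s * z y s \<le> B"
    proof (cases "z y s \<le> 0")
      case True
      then have "E s * z y s \<le> 0" using E[of s] by (simp add: mult_nonneg_nonpos)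
      then show ?thesis using Bpos by simp
    next
      case z: False
      then have "E s * z y s \<le> 1 * z y s" using E1[OF s] by (intro mult_right_mono) auto
      then show ?thesis using B[OF that(1)] by simp
    qed
    also have "B \<le> \<delta> * (y\<^sup>2 + 2 * (s - t0))"
      using BR[of y] False \<delta> s by (simp add: distrib_left add_increasing2)
    finally have "\<phi> y s \<le> 0" by (simp add: \<phi>_def)
    then show ?thesis using \<phi>1 by simp
  qed
  have z1: "z x1 t1 > 0"
  proof (rule ccontr)
    assume "\<not> z x1 t1 > 0"
    then have "E t1 * z x1 t1 \<le> 0" using E[of t1] by (simp add: mult_nonneg_nonpos)
    moreover have "\<delta> * (x1\<^sup>2 + 2 * (t1 - t0)) \<ge> 0" using \<delta> t1 by simp
    ultimately show False using \<phi>1 by (simp add: \<phi>_def)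
  qed
  obtain zt zxx where "(x1, t1) \<in> interior G" and pd: "parabolic_derivs z x1 t1 zt zxx"
    and ineq: "zt \<le> zxx + K * z x1 t1"
    using par[OF p_in z1] by blast
  then obtain e1 where e1: "e1 > 0" "ball (x1, t1) e1 \<subseteq> G" by (auto simp: mem_interior)
  obtain zx where zx: "\<forall>\<^sub>F y in nhds x1. ((\<lambda>y. z y t1) has_real_derivative zx y) (at y)"
    and zxx: "(zx has_real_derivative zxx) (at x1 within {x1..})"
    and zt: "((\<lambda>s. z x1 s) has_real_derivative zt) (at t1)"
    using pd by (auto simp: parabolic_derivs_def)
  obtain e2 where e2: "e2 > 0" "\<And>y. dist y x1 < e2 \<Longrightarrow> ((\<lambda>y. z y t1) has_real_derivative zx y) (at y)"
    using zx by (auto simp: eventually_nhds_metric)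
  define e where "e = min e1 e2"
  have e: "e > 0" using e1 e2 by (simp add: e_def)
  have "E t1 * zxx - 2 * \<delta> \<le> 0"
  proof (rule right_second_derivative_at_max[OF e, of x1 "\<lambda>y. \<phi> y t1" "\<lambda>y. E t1 * zx y - 2 * \<delta> * y"])
    fix y assume y: "\<bar>y - x1\<bar> < e"
    have "((\<lambda>y. z y t1) has_real_derivative zx y) (at y)"
      using y by (intro e2) (auto simp: e_def dist_real_def)
    then show "((\<lambda>y. \<phi> y t1) has_real_derivative E t1 * zx y - 2 * \<delta> * y) (at y)"
      unfolding \<phi>_def by (auto intro!: derivative_eq_intros)
    have "(y, t1) \<in> G"
      using y e1(2) by (auto simp: e_def dist_Pair_Pair dist_real_def abs_minus_commute)
    then show "\<phi> y t1 \<le> \<phi> x1 t1" using max t1 by auto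
  next
    show "((\<lambda>y. E t1 * zx y - 2 * \<delta> * y) has_real_derivative E t1 * zxx - 2 * \<delta>) (at x1 within {x1..})"
      by (auto intro!: derivative_eq_intros zxx)
  qed
  \<comment> \<open>The maximum may lie at the final time \<open>T\<close>, so only earlier times
    are compared and the time derivative is known to be nonnegative, not zero.\<close>
  moreover have "- (K + 1) * E t1 * z x1 t1 + E t1 * zt - 2 * \<delta> \<ge> 0"
  proof (rule ccontr)
    assume neg: "\<not> ?thesis"
    have "((\<lambda>s. \<phi> x1 s) has_real_derivative - (K + 1) * E t1 * z x1 t1 + E t1 * zt - 2 * \<delta>) (at t1)"
      unfolding \<phi>_def E_def by (auto intro!: derivative_eq_intros zt simp: algebra_simps)
    then obtain d where d: "d > 0" "\<And>h. h > 0 \<Longrightarrow> h < d \<Longrightarrow> \<phi> x1 t1 < \<phi> x1 (t1 - h)"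
      using DERIV_neg_dec_left[of "\<lambda>s. \<phi> x1 s"] neg by (meson not_le)
    define h where "h = min d e1 / 2"
    have h: "h > 0" "h < d" "h < e1" using d(1) e1(1) by (auto simp: h_def min_def)
    have "(x1, t1 - h) \<in> G" using h e1(2) by (auto simp: dist_Pair_Pair dist_real_def)
    then show False using max[of x1 "t1 - h"] d(2)[OF h(1,2)] h t1 by auto
  qed
  ultimately have "E t1 * zxx + (K + 1) * E t1 * z x1 t1 \<le> E t1 * zt" by (simp add: algebra_simps)
  also have "\<dots> \<le> E t1 * (zxx + K * z x1 t1)" using ineq E[of t1] by (intro mult_left_mono) auto
  finally have "E t1 * z x1 t1 \<le> 0" by (simp add: algebra_simps)
  then show False using E[of t1] z1 by (simp add: mult_le_0_iff)
qed

section \<open>Comparison with the solution of the front problem\<close>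

lemma is_solution_bounded:
  assumes "is_solution f u0 u"
  obtains M where "M > 0" "\<And>x t. t \<ge> 0 \<Longrightarrow> \<bar>u x t\<bar> \<le> M"
proof -
  have "bounded ((\<lambda>(x, t). u x t) ` (UNIV \<times> {0..}))" using assms by (simp add: is_solution_def)
  then obtain M where "M > 0" "\<And>p. p \<in> (\<lambda>(x, t). u x t) ` (UNIV \<times> {0..}) \<Longrightarrow> norm p \<le> M"
    unfolding bounded_pos by blast
  then show thesis using that[of M] by force
qed

lemma is_solution_parabolic_derivs:
  assumes "is_solution f u0 u" "t > 0"
  obtains D where "parabolic_derivs u x t (D + f (u x t)) D"
proof -
  obtain ut ux uxx where h: "\<And>x. ((\<lambda>s. u x s) has_real_derivative ut x t) (at t)"
      "\<And>x. ((\<lambda>y. u y t) has_real_derivative ux x t) (at x)"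
      "\<And>x. ((\<lambda>y. ux y t) has_real_derivative uxx x t) (at x)"
      "\<And>x. ut x t = uxx x t + f (u x t)"
    using assms unfolding is_solution_def by blast
  have "parabolic_derivs u x t (ut x t) (uxx x t)"
    using h by (intro parabolic_derivsI[of _ _ "\<lambda>y. ux y t"]) (auto intro: has_field_derivative_at_within)
  then show thesis using h(4)[of x] that by simp
qed

lemma interior_halfplane: "t > t0 \<Longrightarrow> (x, t) \<in> interior (UNIV \<times> {t0..} :: (real \<times> real) set)"
  by (simp add: interior_Times)

locale front_problem =
  fixes f u0 :: "real \<Rightarrow> real" and u :: "real \<Rightarrow> real \<Rightarrow> real" and a b :: real
  assumes sol: "is_solution f u0 u"
    and f_lip: "\<And>M. \<exists>K\<ge>0. \<forall>y\<in>{-M..M}. \<forall>z\<in>{-M..M}. \<bar>f y - f z\<bar> \<le> K * \<bar>y - z\<bar>"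
    and f_ends: "f 0 = 0" "f 1 = 0"
    and f_nonneg: "\<And>y. 0 \<le> y \<Longrightarrow> y \<le> 1 \<Longrightarrow> f y \<ge> 0"
    and u0_range: "\<And>x. 0 \<le> u0 x" "\<And>x. u0 x \<le> 1"
    and u0_left: "\<And>x. x \<le> a \<Longrightarrow> u0 x = 1"
    and u0_right: "\<And>x. x \<ge> b \<Longrightarrow> u0 x = 0"
begin

lemma u_initial: "u x 0 = u0 x" using sol by (simp add: is_solution_def)

lemma u_cont: "continuous_on (UNIV \<times> {0..}) (\<lambda>(x, t). u x t)"
  using sol by (simp add: is_solution_def)

text \<open>The constants \<open>0\<close> and \<open>1\<close> solve the equation. As the range of
  \<open>u\<close> is still unknown, the Lipschitz constant of \<open>f\<close> is taken on an
  interval containing the a priori bound \<open>M\<close> as well as \<open>1\<close>.\<close>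

lemma u_range: assumes t: "t \<ge> 0" shows "0 \<le> u x t" "u x t \<le> 1"
proof -
  obtain M where M: "M > 0" "\<And>x t. t \<ge> 0 \<Longrightarrow> \<bar>u x t\<bar> \<le> M" using is_solution_bounded[OF sol] by blast
  obtain K where K: "K \<ge> 0" and lip: "\<And>y z. \<bar>y\<bar> \<le> max M 1 \<Longrightarrow> \<bar>z\<bar> \<le> max M 1 \<Longrightarrow> \<bar>f y - f z\<bar> \<le> K * \<bar>y - z\<bar>"
    using f_lip[of "max M 1"] by (force simp: abs_le_iff)
  have "u x t - 1 \<le> 0"
  proof (rule maximum_principle[where z = "\<lambda>x t. u x t - 1" and G = "UNIV \<times> {0..}" and ?t0.0 = 0 and B = M and K = K])
    show "continuous_on (UNIV \<times> {0..}) (\<lambda>(x, t). u x t - 1)"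
      using u_cont by (auto simp: case_prod_unfold intro!: continuous_intros)
  next
    fix x s assume "(x, s) \<in> UNIV \<times> {0::real..}" and pos: "u x s - 1 > 0"
    then have s: "s > 0" using u_initial[of x] u0_range(2)[of x] by (cases "s = 0") auto
    obtain D where "parabolic_derivs u x s (D + f (u x s)) D"
      using is_solution_parabolic_derivs[OF sol s] by blast
    moreover have "parabolic_derivs (\<lambda>_ _. 1) x s 0 0"
      by (rule parabolic_derivsI[where zx = "\<lambda>_. 0"]) auto
    ultimately have "parabolic_derivs (\<lambda>x t. u x t - 1) x s (D + f (u x s) - 0) (D - 0)"
      by (rule parabolic_derivs_diff)
    moreover have "f (u x s) \<le> K * (u x s - 1)"
      using lip[of "u x s" 1] M(2)[of s x] s pos f_ends by auto
    ultimately show "(x, s) \<in> interior (UNIV \<times> {0..}) \<and>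
       (\<exists>zt zxx. parabolic_derivs (\<lambda>x t. u x t - 1) x s zt zxx \<and> zt \<le> zxx + K * (u x s - 1))"
      using interior_halfplane[OF s] by force
  next
    show "u x t - 1 \<le> M" if "(x, t) \<in> UNIV \<times> {0..}" for x t using M(2)[of t x] that by auto
  qed (use t K in \<open>auto intro: closed_Times\<close>)
  then show "u x t \<le> 1" by simp
  have "0 - u x t \<le> 0"
  proof (rule maximum_principle[where z = "\<lambda>x t. 0 - u x t" and G = "UNIV \<times> {0..}" and ?t0.0 = 0 and B = M and K = K])
    show "continuous_on (UNIV \<times> {0..}) (\<lambda>(x, t). 0 - u x t)"
      using u_cont by (auto simp: case_prod_unfold intro!: continuous_intros)
  next
    fix x s assume "(x, s) \<in> UNIV \<times> {0::real..}" and pos: "0 - u x s > 0"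
    then have s: "s > 0" using u_initial[of x] u0_range(1)[of x] by (cases "s = 0") auto
    obtain D where D: "parabolic_derivs u x s (D + f (u x s)) D"
      using is_solution_parabolic_derivs[OF sol s] by blast
    have "parabolic_derivs (\<lambda>_ _. 0) x s 0 0"
      by (rule parabolic_derivsI[where zx = "\<lambda>_. 0"]) auto
    from parabolic_derivs_diff[OF this D]
    have "parabolic_derivs (\<lambda>x t. 0 - u x t) x s (0 - (D + f (u x s))) (0 - D)" .
    moreover have "\<bar>f (u x s) - f 0\<bar> \<le> K * \<bar>u x s - 0\<bar>"
      using M(2)[of s x] s by (intro lip) auto
    then have "- f (u x s) \<le> K * (0 - u x s)"
      using pos f_ends by (simp add: abs_le_iff)
    ultimately show "(x, s) \<in> interior (UNIV \<times> {0..}) \<and>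
       (\<exists>zt zxx. parabolic_derivs (\<lambda>x t. 0 - u x t) x s zt zxx \<and> zt \<le> zxx + K * (0 - u x s))"
      using interior_halfplane[OF s] by force
  next
    show "0 - u x t \<le> M" if "(x, t) \<in> UNIV \<times> {0..}" for x t using M(2)[of t x] that by auto
  qed (use t K in \<open>auto intro: closed_Times\<close>)
  then show "0 \<le> u x t" by simp
qed

lemma lip01: "\<exists>K\<ge>0. \<forall>y z. 0 \<le> y \<longrightarrow> y \<le> 1 \<longrightarrow> 0 \<le> z \<longrightarrow> z \<le> 1 \<longrightarrow> \<bar>f y - f z\<bar> \<le> K * \<bar>y - z\<bar>"
  using f_lip[of 1] by force

text \<open>Conditions on \<open>w\<close> are imposed only where \<open>w > u\<close>, hence only
  where \<open>w > 0\<close>: a wave may descend below \<open>0\<close>, outside the range in which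
  \<open>f\<close> has a known sign. On the boundary of \<open>G\<close> the hypothesis says
  \<open>w \<le> u\<close>.\<close>

lemma sub_comparison:
  assumes G: "closed G" "\<And>x t. (x, t) \<in> G \<Longrightarrow> t0 \<le> t" and "t0 \<ge> 0"
    and cont: "continuous_on G (\<lambda>(x, t). w x t)"
    and le1: "\<And>x t. (x, t) \<in> G \<Longrightarrow> w x t \<le> 1"
    and sub: "\<And>x t. (x, t) \<in> G \<Longrightarrow> u x t < w x t \<Longrightarrow> (x, t) \<in> interior G \<and>
      (\<exists>wt wxx. parabolic_derivs w x t wt wxx \<and> wt \<le> wxx + f (w x t))"
    and xt: "(x, t) \<in> G"
  shows "w x t \<le> u x t"
proof -
  obtain K where K: "K \<ge> 0" and lip: "\<And>y z. 0 \<le> y \<Longrightarrow> y \<le> 1 \<Longrightarrow> 0 \<le> z \<Longrightarrow> z \<le> 1 \<Longrightarrow> \<bar>f y - f z\<bar> \<le> K * \<bar>y - z\<bar>"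
    using lip01 by blast
  have "w x t - u x t \<le> 0"
  proof (rule maximum_principle[where z = "\<lambda>x t. w x t - u x t" and G = G and ?t0.0 = t0 and B = 1 and K = K])
    have "continuous_on G (\<lambda>(x, t). u x t)"
      by (rule continuous_on_subset[OF u_cont]) (use G(2) \<open>t0 \<ge> 0\<close> in force)
    then show "continuous_on G (\<lambda>(x, t). w x t - u x t)"
      using cont by (auto simp: case_prod_unfold intro!: continuous_intros)
  next
    fix x s assume xs: "(x, s) \<in> G" and pos: "w x s - u x s > 0"
    have int: "(x, s) \<in> interior G" using sub[OF xs] pos by auto
    then obtain e where "e > 0" "ball (x, s) e \<subseteq> G" by (auto simp: mem_interior)
    \<comment> \<open>An interior point has earlier points of \<open>G\<close> below it, so
      \<open>s > t0 \<ge> 0\<close>, and at \<open>s\<close> the solution is differentiable.\<close>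
    then have "(x, s - e/2) \<in> G" by (auto simp: dist_Pair_Pair dist_real_def)
    then have s: "s > 0" using G(2) \<open>t0 \<ge> 0\<close> \<open>e > 0\<close> by fastforce
    obtain wt wxx where w: "parabolic_derivs w x s wt wxx" "wt \<le> wxx + f (w x s)"
      using sub[OF xs] pos by auto
    obtain D where "parabolic_derivs u x s (D + f (u x s)) D"
      using is_solution_parabolic_derivs[OF sol s] by blast
    from parabolic_derivs_diff[OF w(1) this]
    have "parabolic_derivs (\<lambda>x t. w x t - u x t) x s (wt - (D + f (u x s))) (wxx - D)" .
    moreover have "f (w x s) - f (u x s) \<le> K * (w x s - u x s)"
      using lip[of "w x s" "u x s"] le1[OF xs] u_range[of s x] s pos by auto
    ultimately show "(x, s) \<in> interior G \<and>
       (\<exists>zt zxx. parabolic_derivs (\<lambda>x t. w x t - u x t) x s zt zxx \<and> zt \<le> zxx + K * (w x s - u x s))"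
      using int w(2) by (intro conjI exI[of _ "wt - (D + f (u x s))"] exI[of _ "wxx - D"]) auto
  next
    show "w x t - u x t \<le> 1" if "(x, t) \<in> G" for x t
      using le1[OF that] u_range[of t x] G(2)[OF that] \<open>t0 \<ge> 0\<close> by auto
  qed (use G xt K in auto)
  then show ?thesis by simp
qed

text \<open>The inequality for \<open>w\<close> is asked only where \<open>w < u\<close>, hence only
  where \<open>w < 1\<close>; a profile may therefore be continued above \<open>1\<close>
  arbitrarily.\<close>

lemma super_comparison:
  assumes cont: "continuous_on (UNIV \<times> {0..}) (\<lambda>(x, t). w x t)"
    and ge0: "\<And>x t. 0 \<le> t \<Longrightarrow> 0 \<le> w x t"
    and init: "\<And>x. u0 x \<le> w x 0"
    and super: "\<And>x t. t > 0 \<Longrightarrow> w x t < u x t \<Longrightarrow>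
      \<exists>wt wxx. parabolic_derivs w x t wt wxx \<and> wt \<ge> wxx + f (w x t)"
    and t: "t \<ge> 0"
  shows "u x t \<le> w x t"
proof -
  obtain K where K: "K \<ge> 0" and lip: "\<And>y z. 0 \<le> y \<Longrightarrow> y \<le> 1 \<Longrightarrow> 0 \<le> z \<Longrightarrow> z \<le> 1 \<Longrightarrow> \<bar>f y - f z\<bar> \<le> K * \<bar>y - z\<bar>"
    using lip01 by blast
  have "u x t - w x t \<le> 0"
  proof (rule maximum_principle[where z = "\<lambda>x t. u x t - w x t" and G = "UNIV \<times> {0..}" and ?t0.0 = 0 and B = 1 and K = K])
    show "continuous_on (UNIV \<times> {0..}) (\<lambda>(x, t). u x t - w x t)"
      using cont u_cont by (auto simp: case_prod_unfold intro!: continuous_intros)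
  next
    fix x s assume "(x, s) \<in> UNIV \<times> {0::real..}" and pos: "u x s - w x s > 0"
    then have s: "s > 0" using u_initial[of x] init[of x] by (cases "s = 0") auto
    obtain wt wxx where w: "parabolic_derivs w x s wt wxx" "wt \<ge> wxx + f (w x s)"
      using super[OF s, of x] pos by auto
    obtain D where D: "parabolic_derivs u x s (D + f (u x s)) D"
      using is_solution_parabolic_derivs[OF sol s] by blast
    from parabolic_derivs_diff[OF this w(1)]
    have "parabolic_derivs (\<lambda>x t. u x t - w x t) x s (D + f (u x s) - wt) (D - wxx)" .
    moreover have "f (u x s) - f (w x s) \<le> K * (u x s - w x s)"
      using lip[of "u x s" "w x s"] ge0[of s x] u_range[of s x] s pos by auto
    ultimately show "(x, s) \<in> interior (UNIV \<times> {0..}) \<and>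
       (\<exists>zt zxx. parabolic_derivs (\<lambda>x t. u x t - w x t) x s zt zxx \<and> zt \<le> zxx + K * (u x s - w x s))"
      using interior_halfplane[OF s] w(2) by (intro conjI exI[of _ "D + f (u x s) - wt"] exI[of _ "D - wxx"]) auto
  next
    show "u x t - w x t \<le> 1" if "(x, t) \<in> UNIV \<times> {0..}" for x t
      using u_range[of t x] ge0[of t x] that by auto
  qed (use t K in \<open>auto intro: closed_Times\<close>)
  then show ?thesis by simp
qed

end

section \<open>Travelling profiles\<close>

text \<open>\<open>U\<close> is the inverse of an antiderivative \<open>X\<close> of
  \<open>- (1 / v)\<close>, so continuity of \<open>v\<close> suffices. The linear bounds make the
  integral of \<open>1 / v\<close> diverge at \<open>\<alpha>\<close> and \<open>\<beta>\<close>;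
  thus \<open>X\<close> maps onto the line and \<open>U\<close> is defined everywhere.\<close>

lemma decreasing_profile:
  fixes v :: "real \<Rightarrow> real"
  assumes "\<alpha> < \<beta>" and cont: "continuous_on {\<alpha><..<\<beta>} v"
    and v: "\<And>q. \<alpha> < q \<Longrightarrow> q < \<beta> \<Longrightarrow> 0 < v q"
    and v\<alpha>: "\<And>q. \<alpha> < q \<Longrightarrow> q < \<beta> \<Longrightarrow> v q \<le> C * (q - \<alpha>)"
    and v\<beta>: "\<And>q. \<alpha> < q \<Longrightarrow> q < \<beta> \<Longrightarrow> v q \<le> C * (\<beta> - q)"
  obtains U where "\<And>\<xi>. \<alpha> < U \<xi>" "\<And>\<xi>. U \<xi> < \<beta>"
    "\<And>\<xi>. (U has_real_derivative - v (U \<xi>)) (at \<xi>)"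
    "(U \<longlongrightarrow> \<alpha>) at_top" "(U \<longlongrightarrow> \<beta>) at_bot"
proof -
  have isCont_v: "isCont v q" if "\<alpha> < q" "q < \<beta>" for q
    using cont that by (simp add: continuous_on_eq_continuous_at)
  have "\<exists>F. \<forall>q. \<alpha> < q \<longrightarrow> q < \<beta> \<longrightarrow> (F has_vector_derivative - (1 / v q)) (at q)"
    using einterval_antiderivative[of "ereal \<alpha>" "ereal \<beta>" "\<lambda>q. - (1 / v q)"] assms(1) isCont_v v
    by (force intro!: continuous_intros)
  then obtain X where X: "\<And>q. \<alpha> < q \<Longrightarrow> q < \<beta> \<Longrightarrow> (X has_real_derivative - (1 / v q)) (at q)"
    by (auto simp: has_real_derivative_iff_has_vector_derivative)
  have X_dec: "X q > X q'" if "\<alpha> < q" "q < q'" "q' < \<beta>" for q q'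
  proof (rule DERIV_neg_imp_decreasing[OF that(2)])
    show "\<exists>y. (X has_real_derivative y) (at s) \<and> y < 0" if "q \<le> s" "s \<le> q'" for s
      using X[of s] v[of s] \<open>\<alpha> < q\<close> \<open>q' < \<beta>\<close> that by (intro exI[of _ "- (1 / v s)"]) auto
  qed
  define m where "m = (\<alpha> + \<beta>) / 2"
  have m: "\<alpha> < m" "m < \<beta>" using assms(1) by (auto simp: m_def)
  have "0 < C * (m - \<alpha>)" using v[OF m] v\<alpha>[OF m] by linarith
  then have C: "C > 0" using m by (simp add: zero_less_mult_iff)
  have onto: "\<exists>q. \<alpha> < q \<and> q < \<beta> \<and> X q = \<xi>" for \<xi>
  proof (cases "\<xi> \<ge> X m")
    case True
    \<comment> \<open>The value at \<open>\<xi>\<close> of the explicit profile for the slope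
      \<open>C * (q - \<alpha>)\<close> that passes through \<open>m\<close> at \<open>X m\<close>.
      Since \<open>v\<close> is no steeper, \<open>X q1 \<ge> \<xi>\<close>, and the intermediate
      value theorem applies. The other case uses the slope \<open>C * (\<beta> - q)\<close> in the
      same way.\<close>
    define q1 where "q1 = \<alpha> + (m - \<alpha>) * exp (- C * (\<xi> - X m))"
    have "exp (- C * (\<xi> - X m)) \<le> 1" using True C by (simp add: mult_nonpos_nonneg)
    then have "(m - \<alpha>) * exp (- C * (\<xi> - X m)) \<le> (m - \<alpha>) * 1" using m by (intro mult_left_mono) auto
    then have "q1 - \<alpha> \<le> m - \<alpha>" by (simp only: q1_def add_diff_cancel_left' mult_1_right)
    then have "q1 \<le> m" by simp
    moreover have "\<alpha> < q1" unfolding q1_def using m by simp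
    ultimately have q1: "\<alpha> < q1" "q1 \<le> m" by simp_all
    have "X m + ln (m - \<alpha>) / C \<le> X q1 + ln (q1 - \<alpha>) / C"
    proof (rule DERIV_nonpos_imp_nonincreasing[OF q1(2), where f = "\<lambda>q. X q + ln (q - \<alpha>) / C"])
      fix q assume "q1 \<le> q" "q \<le> m"
      then have q: "\<alpha> < q" "q < \<beta>" using q1 m by auto
      have "((\<lambda>q. X q + ln (q - \<alpha>) / C) has_real_derivative - (1 / v q) + 1 / (q - \<alpha>) / C) (at q)"
        using q C by (auto intro!: derivative_eq_intros X)
      moreover have "1 / (C * (q - \<alpha>)) \<le> 1 / v q"
        using v[OF q] v\<alpha>[OF q] by (intro divide_left_mono) auto
      ultimately show "\<exists>y. ((\<lambda>q. X q + ln (q - \<alpha>) / C) has_real_derivative y) (at q) \<and> y \<le> 0"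
        by (intro exI[of _ "- (1 / v q) + 1 / (q - \<alpha>) / C"]) (auto simp: mult.commute)
    qed
    moreover have "ln (q1 - \<alpha>) = ln (m - \<alpha>) - C * (\<xi> - X m)"
      using m by (simp add: q1_def ln_mult)
    then have "ln (q1 - \<alpha>) / C = ln (m - \<alpha>) / C - (\<xi> - X m)"
      using C by (simp add: diff_divide_distrib)
    ultimately have "\<xi> \<le> X q1" by linarith
    then obtain q where "q1 \<le> q" "q \<le> m" "X q = \<xi>"
      using IVT2[of X m \<xi> q1] True q1 m X by (metis DERIV_isCont le_less_trans less_le_trans)
    then show ?thesis using q1 m by (intro exI[of _ q]) auto
  next
    case False
    define q1 where "q1 = \<beta> - (\<beta> - m) * exp (C * (\<xi> - X m))"
    have "exp (C * (\<xi> - X m)) \<le> 1" using False C by (simp add: mult_nonneg_nonpos)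
    then have "(\<beta> - m) * exp (C * (\<xi> - X m)) \<le> (\<beta> - m) * 1" using m by (intro mult_left_mono) auto
    then have "\<beta> - q1 \<le> \<beta> - m" by (simp only: q1_def diff_diff_eq2 add_diff_cancel_left' mult_1_right)
    then have "m \<le> q1" by simp
    moreover have "q1 < \<beta>" unfolding q1_def using m by simp
    ultimately have q1: "m \<le> q1" "q1 < \<beta>" by simp_all
    have "X q1 - ln (\<beta> - q1) / C \<le> X m - ln (\<beta> - m) / C"
    proof (rule DERIV_nonpos_imp_nonincreasing[OF q1(1), where f = "\<lambda>q. X q - ln (\<beta> - q) / C"])
      fix q assume "m \<le> q" "q \<le> q1"
      then have q: "\<alpha> < q" "q < \<beta>" using q1 m by auto
      have "((\<lambda>q. X q - ln (\<beta> - q) / C) has_real_derivative - (1 / v q) + 1 / (\<beta> - q) / C) (at q)"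
        using q C by (auto intro!: derivative_eq_intros X)
      moreover have "1 / (C * (\<beta> - q)) \<le> 1 / v q"
        using v[OF q] v\<beta>[OF q] by (intro divide_left_mono) auto
      ultimately show "\<exists>y. ((\<lambda>q. X q - ln (\<beta> - q) / C) has_real_derivative y) (at q) \<and> y \<le> 0"
        by (intro exI[of _ "- (1 / v q) + 1 / (\<beta> - q) / C"]) (auto simp: mult.commute)
    qed
    moreover have "ln (\<beta> - q1) = ln (\<beta> - m) + C * (\<xi> - X m)"
      using m by (simp add: q1_def ln_mult)
    then have "ln (\<beta> - q1) / C = ln (\<beta> - m) / C + (\<xi> - X m)"
      using C by (simp add: add_divide_distrib)
    ultimately have "X q1 \<le> \<xi>" by linarith
    then obtain q where "m \<le> q" "q \<le> q1" "X q = \<xi>"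
      using IVT2[of X q1 \<xi> m] False q1 m X by (metis DERIV_isCont le_less_trans less_le_trans linear)
    then show ?thesis using q1 m by (intro exI[of _ q]) auto
  qed
  then obtain U where U: "\<And>\<xi>. \<alpha> < U \<xi>" "\<And>\<xi>. U \<xi> < \<beta>" "\<And>\<xi>. X (U \<xi>) = \<xi>"
    by metis
  have U_inv: "U (X q) = q" if "\<alpha> < q" "q < \<beta>" for q
    using X_dec[of "U (X q)" q] X_dec[of q "U (X q)"] U[of "X q"] that by (metis less_irrefl linorder_neqE_linordered_idom)
  have U_less: "U \<xi> < q" if "\<alpha> < q" "q < \<beta>" "\<xi> > X q" for q \<xi>
    using X_dec[of q "U \<xi>"] U[of \<xi>] U_inv[OF that(1,2)] that
    by (cases "U \<xi>" q rule: linorder_cases) auto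
  have U_greater: "U \<xi> > q" if "\<alpha> < q" "q < \<beta>" "\<xi> < X q" for q \<xi>
    using X_dec[of "U \<xi>" q] U[of \<xi>] U_inv[OF that(1,2)] that
    by (cases "U \<xi>" q rule: linorder_cases) auto
  show thesis
  proof (rule that[OF U(1,2)])
    fix \<xi>
    have cont: "isCont U (X (U \<xi>))"
    proof (rule isCont_inverse_function2[where f = X and x = "U \<xi>" and a = "(\<alpha> + U \<xi>) / 2" and b = "(\<beta> + U \<xi>) / 2"])
      show "(\<alpha> + U \<xi>) / 2 < U \<xi>" "U \<xi> < (\<beta> + U \<xi>) / 2" using U[of \<xi>] by auto
      fix z assume "(\<alpha> + U \<xi>) / 2 \<le> z" "z \<le> (\<beta> + U \<xi>) / 2"
      then have z: "\<alpha> < z" "z < \<beta>" using U(1)[of \<xi>] U(2)[of \<xi>] by auto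
      show "U (X z) = z" by (rule U_inv[OF z])
      show "isCont X z" by (rule DERIV_isCont[OF X[OF z]])
    qed
    have "(U has_real_derivative inverse (- (1 / v (U \<xi>)))) (at \<xi>)"
    proof (rule DERIV_inverse_function)
      show "(X has_real_derivative - (1 / v (U \<xi>))) (at (U \<xi>))" by (rule X[OF U(1,2)])
      show "- (1 / v (U \<xi>)) \<noteq> 0" using v[OF U(1,2), of \<xi>] by simp
      show "\<xi> - 1 < \<xi>" "\<xi> < \<xi> + 1" by auto
      show "isCont U \<xi>" using cont U(3) by simp
    qed (rule U(3))
    then show "(U has_real_derivative - v (U \<xi>)) (at \<xi>)" by simp
  next
    show "(U \<longlongrightarrow> \<alpha>) at_top"
    proof (rule order_tendstoI)
      show "eventually (\<lambda>\<xi>. a < U \<xi>) at_top" if "a < \<alpha>" for a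
        by (rule always_eventually) (use that U(1) in \<open>auto intro: less_trans\<close>)
      show "eventually (\<lambda>\<xi>. U \<xi> < a) at_top" if "\<alpha> < a" for a
      proof -
        have *: "\<alpha> < min a m" "min a m < \<beta>" using that m by auto
        show ?thesis
          using eventually_gt_at_top[of "X (min a m)"]
        proof eventually_elim
          case (elim \<xi>)
          show ?case using U_less[OF * elim] by simp
        qed
      qed
    qed
    show "(U \<longlongrightarrow> \<beta>) at_bot"
    proof (rule order_tendstoI)
      show "eventually (\<lambda>\<xi>. U \<xi> < a) at_bot" if "\<beta> < a" for a
        by (rule always_eventually) (use that U(2) in \<open>auto intro: less_trans\<close>)
      show "eventually (\<lambda>\<xi>. a < U \<xi>) at_bot" if "a < \<beta>" for a
      proof -
        have *: "\<alpha> < max a m" "max a m < \<beta>" using that m by auto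
        show ?thesis
          using eventually_gt_at_bot[of "X (max a m)"]
        proof eventually_elim
          case (elim \<xi>)
          show ?case using U_greater[OF * elim] by simp
        qed
      qed
    qed
  qed
qed

lemma profile_antimono:
  fixes U :: "real \<Rightarrow> real"
  assumes U: "\<And>\<xi>. (U has_real_derivative - v (U \<xi>)) (at \<xi>)" "\<And>\<xi>. v (U \<xi>) \<ge> 0" and "\<xi> \<le> \<zeta>"
  shows "U \<zeta> \<le> U \<xi>"
proof (rule DERIV_nonpos_imp_nonincreasing[OF assms(3)])
  show "\<exists>y. (U has_real_derivative y) (at x) \<and> y \<le> 0" for x
    using U by (intro exI[of _ "- v (U x)"]) auto
qed

text \<open>From \<open>U' = - v U\<close> one gets the second space derivative
  \<open>v * v'\<close> and the time derivative \<open>c * v\<close>, so the sign of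
  \<open>v * v' - c * v + f\<close> decides. As \<open>U\<close> decreases, moving right in
  \<open>x\<close> moves down in value; hence the right derivative in space needs the derivative of
  \<open>v\<close> from the left only.\<close>

lemma parabolic_derivs_wave:
  assumes U: "\<And>\<xi>. (U has_real_derivative - v (U \<xi>)) (at \<xi>)" "\<And>\<xi>. v (U \<xi>) \<ge> 0"
    and D: "(v has_real_derivative D) (at (U (x - c * t + s)) within {..U (x - c * t + s)})"
  shows "parabolic_derivs (\<lambda>x t. U (x - c * t + s)) x t
    (c * v (U (x - c * t + s))) (v (U (x - c * t + s)) * D)"
proof (rule parabolic_derivsI)
  let ?\<xi> = "\<lambda>y. y - c * t + s"
  have \<xi>': "(?\<xi> has_real_derivative 1) (at y within A)" for y A by (auto intro!: derivative_eq_intros)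
  show Ux: "((\<lambda>y. U (?\<xi> y)) has_real_derivative - v (U (?\<xi> y))) (at y)" for y
    using DERIV_chain2[OF U(1) \<xi>'] by simp
  have "(v has_real_derivative D) (at (U (?\<xi> x)) within (\<lambda>y. U (?\<xi> y)) ` {x..})"
    by (rule has_field_derivative_subset[OF D]) (auto intro!: profile_antimono[where v = v, OF U])
  from DERIV_minus[OF DERIV_image_chain[OF this has_field_derivative_at_within[OF Ux]]]
  show "((\<lambda>y. - v (U (?\<xi> y))) has_real_derivative v (U (?\<xi> x)) * D) (at x within {x..})"
    by (simp add: o_def mult.commute)
  have "((\<lambda>t. x - c * t + s) has_real_derivative - c) (at t)" by (auto intro!: derivative_eq_intros)
  from DERIV_chain2[OF U(1) this]
  show "((\<lambda>t. U (x - c * t + s)) has_real_derivative c * v (U (x - c * t + s))) (at t)"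
    by (simp add: mult.commute)
qed

lemma continuous_on_wave:
  fixes U :: "real \<Rightarrow> real"
  assumes "\<And>\<xi>. (U has_real_derivative d \<xi>) (at \<xi>)"
  shows "continuous_on A (\<lambda>(x, t). U (x - c * t + s))"
proof -
  have "continuous_on UNIV U" using assms by (meson DERIV_isCont continuous_at_imp_continuous_on)
  then show ?thesis unfolding case_prod_unfold
    by (rule continuous_on_compose2) (auto intro!: continuous_intros)
qed

section \<open>Bounds on the solution by moving waves\<close>

context front_problem
begin

lemma upper_front:
  assumes "0 \<le> l" "l < 1" and cont: "continuous_on {l<..1} v"
    and v: "\<And>q. l < q \<Longrightarrow> q \<le> 1 \<Longrightarrow> 0 < v q"
    and vC: "\<And>q. l < q \<Longrightarrow> q \<le> 1 \<Longrightarrow> v q \<le> C * (q - l)"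
    and D: "\<And>q. l < q \<Longrightarrow> q < 1 \<Longrightarrow>
      \<exists>D. (v has_real_derivative D) (at q within {..q}) \<and> v q * D - c * v q + f q \<le> 0"
    and "c < c2" "\<delta> > 0"
  shows "\<exists>t0. \<forall>t\<ge>t0. \<forall>x\<ge>c2 * t. u x t \<le> l + \<delta>"
proof -
  \<comment> \<open>As \<open>v 1 > 0\<close>, the profile reaches \<open>1\<close> at a finite
    point. The linear continuation to a zero at \<open>2\<close> makes it global; values above
    \<open>1\<close> are never tested against \<open>u\<close>.\<close>
  define w where "w q = (if q \<le> 1 then v q else v 1 * (2 - q))" for q
  have "0 < C * (1 - l)" using v[of 1] vC[of 1] \<open>l < 1\<close> by linarith
  then have C: "C > 0" using \<open>l < 1\<close> by (simp add: zero_less_mult_iff)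
  have wcont: "continuous_on {l<..<2} w"
    unfolding w_def
    by (rule continuous_on_cases_le) (auto intro!: continuous_intros continuous_on_subset[OF cont])
  have wpos: "0 < w q" if "l < q" "q < 2" for q using that v[of q] v[of 1] \<open>l < 1\<close> by (auto simp: w_def)
  have w1: "w q \<le> C * (q - l)" if q: "l < q" "q < 2" for q
  proof (cases "q \<le> 1")
    case False
    then have "v 1 * (2 - q) \<le> v 1 * 1" using v[of 1] \<open>l < 1\<close> by (intro mult_left_mono) auto
    also have "\<dots> \<le> C * (1 - l)" using vC[of 1] \<open>l < 1\<close> by simp
    also have "\<dots> \<le> C * (q - l)" using C False by (intro mult_left_mono) auto
    finally show ?thesis using False by (simp add: w_def)
  qed (use q vC in \<open>auto simp: w_def\<close>)
  have w2: "w q \<le> C * (2 - q)" if q: "l < q" "q < 2" for q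
  proof (cases "q \<le> 1")
    case True
    have "v q \<le> C * (q - l)" using vC q True by auto
    also have "\<dots> \<le> C * (2 - q)" using C True q \<open>0 \<le> l\<close> by (intro mult_left_mono) auto
    finally show ?thesis using True by (simp add: w_def)
  next
    case False
    have "v 1 \<le> C * (1 - l)" using vC[of 1] \<open>l < 1\<close> by simp
    also have "\<dots> \<le> C * 1" using C \<open>0 \<le> l\<close> by (intro mult_left_mono) auto
    finally have "v 1 \<le> C * 1" .
    then have "v 1 * (2 - q) \<le> (C * 1) * (2 - q)" using q by (intro mult_right_mono) auto
    then show ?thesis using False by (simp add: w_def)
  qed
  obtain U where U: "\<And>\<xi>. l < U \<xi>" "\<And>\<xi>. U \<xi> < 2" "\<And>\<xi>. (U has_real_derivative - w (U \<xi>)) (at \<xi>)"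
    and lim: "(U \<longlongrightarrow> l) at_top" "(U \<longlongrightarrow> 2) at_bot"
    using decreasing_profile[of l 2 w C] wcont wpos w1 w2 \<open>l < 1\<close> by auto
  have wU: "w (U \<xi>) \<ge> 0" for \<xi> using wpos[OF U(1,2)] by (simp add: less_imp_le)
  have "eventually (\<lambda>\<xi>. 1 < U \<xi>) at_bot" using lim(2) by (rule order_tendstoD) simp
  then obtain \<xi>1 where \<xi>1: "\<And>\<xi>. \<xi> \<le> \<xi>1 \<Longrightarrow> 1 < U \<xi>" by (auto simp: eventually_at_bot_linorder)
  \<comment> \<open>With this shift the initial wave exceeds \<open>1\<close> up to
    \<open>b\<close>; to the right of \<open>b\<close> the datum is \<open>0\<close> and the wave is
    above \<open>l \<ge> 0\<close>.\<close>
  define s where "s = \<xi>1 - b"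
  have le: "u x t \<le> U (x - c * t + s)" if "t \<ge> 0" for x t
  proof (rule super_comparison[where w = "\<lambda>x t. U (x - c * t + s)", OF _ _ _ _ that])
    show "continuous_on (UNIV \<times> {0..}) (\<lambda>(x, t). U (x - c * t + s))"
      by (rule continuous_on_wave[OF U(3)])
    show "0 \<le> U (x - c * t + s)" for x t using U(1)[of "x - c * t + s"] \<open>0 \<le> l\<close> by linarith
    show "u0 x \<le> U (x - c * 0 + s)" for x
    proof (cases "x \<le> b")
      case True
      then show ?thesis using \<xi>1[of "x + s"] u0_range(2)[of x] by (simp add: s_def)
    next
      case False
      then show ?thesis using u0_right[of x] U(1)[of "x + s"] \<open>0 \<le> l\<close> by simp
    qed
    fix x t :: real assume t: "t > 0" and less: "U (x - c * t + s) < u x t"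
    let ?q = "U (x - c * t + s)"
    have q: "l < ?q" "?q < 1" using U(1) less u_range(2)[of t x] t by auto
    obtain D' where D': "(v has_real_derivative D') (at ?q within {..?q})" "v ?q * D' - c * v ?q + f ?q \<le> 0"
      using D[OF q] by blast
    have "(w has_real_derivative D') (at ?q within {..?q})"
      by (rule has_field_derivative_transform_within[OF D'(1), of 1]) (use q in \<open>auto simp: w_def\<close>)
    from parabolic_derivs_wave[where v = w, OF U(3) wU this]
    show "\<exists>wt wxx. parabolic_derivs (\<lambda>x t. U (x - c * t + s)) x t wt wxx \<and> wt \<ge> wxx + f ?q"
      using D'(2) q by (intro conjI exI[of _ "c * w ?q"] exI[of _ "w ?q * D'"]) (auto simp: w_def)
  qed
  have "eventually (\<lambda>\<xi>. U \<xi> < l + \<delta>) at_top" using lim(1) by (rule order_tendstoD) (use \<open>\<delta> > 0\<close> in simp)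
  then obtain N where N: "\<And>\<xi>. \<xi> \<ge> N \<Longrightarrow> U \<xi> < l + \<delta>" by (auto simp: eventually_at_top_linorder)
  show ?thesis
  proof (intro exI[of _ "max 0 ((N - s) / (c2 - c))"] allI impI)
    fix t x assume t: "max 0 ((N - s) / (c2 - c)) \<le> t" and x: "c2 * t \<le> x"
    have "(N - s) / (c2 - c) \<le> t" using t by simp
    then have "N - s \<le> (c2 - c) * t" using \<open>c < c2\<close> by (simp add: pos_divide_le_eq mult.commute)
    then have "N \<le> x - c * t + s" using x by (simp add: algebra_simps)
    then show "u x t \<le> l + \<delta>" using N[of "x - c * t + s"] le[of t x] t by auto
  qed
qed

text \<open>\<open>1 - exp (x - a + t)\<close> solves the heat equation and lies below the initial
  datum, so it is a subsolution where it lies in \<open>{0..1}\<close>. It shows that at every later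
  time \<open>u\<close> is still close to \<open>1\<close> far to the left, which lets a lower wave
  start late.\<close>

lemma left_tail:
  assumes "t \<ge> 0"
  shows "u x t \<ge> 1 - exp (x - a + t)"
proof (rule sub_comparison[where G = "UNIV \<times> {0..}" and w = "\<lambda>x t. 1 - exp (x - a + t)" and ?t0.0 = 0])
  show "continuous_on (UNIV \<times> {0..}) (\<lambda>(x, t). 1 - exp (x - a + t))"
    unfolding case_prod_unfold by (intro continuous_intros)
next
  fix x t assume "(x, t) \<in> UNIV \<times> {0::real..}" and less: "u x t < 1 - exp (x - a + t)"
  then have "t \<ge> 0" by simp
  moreover have "t \<noteq> 0"
  proof
    assume "t = 0"
    with less have "u0 x < 1 - exp (x - a)" using u_initial[of x] by simp
    moreover have "exp (x - a) > 1" if "\<not> x \<le> a" using that by simp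
    ultimately show False using u0_left[of x] u0_range(1)[of x] exp_gt_zero[of "x - a"]
      by (cases "x \<le> a") (fastforce, linarith)
  qed
  ultimately have t: "t > 0" by simp
  have "parabolic_derivs (\<lambda>x t. 1 - exp (x - a + t)) x t (- exp (x - a + t)) (- exp (x - a + t))"
    by (rule parabolic_derivsI[where zx = "\<lambda>y. - exp (y - a + t)"]) (auto intro!: derivative_eq_intros)
  moreover have "f (1 - exp (x - a + t)) \<ge> 0"
  proof (rule f_nonneg)
    show "0 \<le> 1 - exp (x - a + t)" using less u_range(1)[of t x] t by linarith
  qed simp
  ultimately show "(x, t) \<in> interior (UNIV \<times> {0..}) \<and> (\<exists>wt wxx.
      parabolic_derivs (\<lambda>x t. 1 - exp (x - a + t)) x t wt wxx \<and> wt \<le> wxx + f (1 - exp (x - a + t)))"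
    using interior_halfplane[OF t] by force
qed (use assms in \<open>auto intro: closed_Times\<close>)

definition spreads_below where
  "spreads_below l c1 \<longleftrightarrow> (\<forall>c<c1. \<forall>\<delta>>0. \<exists>t0. \<forall>t\<ge>t0. \<forall>x\<le>c * t. u x t \<ge> l - \<delta>)"

text \<open>The profile tends to \<open>\<alpha> < l\<close> at the right end, so at some point it
  is below the level \<open>l - \<delta>\<close> that \<open>u\<close> is already known to exceed.
  The comparison runs to the left of a line of speed \<open>c'\<close> with
  \<open>cb < c' < c1\<close>: slow enough for the known bound on \<open>u\<close>, and faster than
  the wave.\<close>

lemma lower_front:
  assumes spread: "spreads_below l c1" and "q1 < 1" and cb: "0 < cb" "cb < c1"
    and \<alpha>: "\<alpha> < l" "l < q1"
    and cont: "continuous_on {\<alpha><..<q1} v"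
    and v: "\<And>q. \<alpha> < q \<Longrightarrow> q < q1 \<Longrightarrow> 0 < v q"
    and v\<alpha>: "\<And>q. \<alpha> < q \<Longrightarrow> q < q1 \<Longrightarrow> v q \<le> C * (q - \<alpha>)"
    and v1: "\<And>q. \<alpha> < q \<Longrightarrow> q < q1 \<Longrightarrow> v q \<le> C * (q1 - q)"
    and D: "\<And>q. \<alpha> < q \<Longrightarrow> 0 < q \<Longrightarrow> q < q1 \<Longrightarrow>
      \<exists>D. (v has_real_derivative D) (at q within {..q}) \<and> v q * D - cb * v q + f q \<ge> 0"
    and "q2 < q1"
  shows "\<exists>t0\<ge>0. \<exists>L. \<forall>t\<ge>t0. \<forall>x\<le>cb * t - L. u x t \<ge> q2"
proof -
  obtain U where U: "\<And>\<xi>. \<alpha> < U \<xi>" "\<And>\<xi>. U \<xi> < q1" "\<And>\<xi>. (U has_real_derivative - v (U \<xi>)) (at \<xi>)"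
    and lim: "(U \<longlongrightarrow> \<alpha>) at_top" "(U \<longlongrightarrow> q1) at_bot"
    using decreasing_profile[of \<alpha> q1 v C] cont v v\<alpha> v1 \<alpha> by auto
  have vU: "v (U \<xi>) \<ge> 0" for \<xi> using v[OF U(1,2)] by (simp add: less_imp_le)
  define \<delta> where "\<delta> = (l - \<alpha>) / 2"
  have \<delta>: "\<delta> > 0" "\<alpha> < l - \<delta>" using \<alpha> by (auto simp: \<delta>_def field_simps)
  define c' where "c' = (cb + c1) / 2"
  have c': "cb < c'" "c' < c1" using cb by (auto simp: c'_def)
  obtain T0 where T0: "\<And>t x. t \<ge> T0 \<Longrightarrow> x \<le> c' * t \<Longrightarrow> u x t \<ge> l - \<delta>"
    using spread c'(2) \<delta>(1) unfolding spreads_below_def by blast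
  define t0 where "t0 = max T0 0"
  have t0: "t0 \<ge> 0" "T0 \<le> t0" by (auto simp: t0_def)
  have "eventually (\<lambda>\<xi>. U \<xi> < l - \<delta>) at_top" using lim(1) \<delta>(2) by (rule order_tendstoD)
  then obtain \<xi>1 where \<xi>1: "\<And>\<xi>. \<xi> \<ge> \<xi>1 \<Longrightarrow> U \<xi> < l - \<delta>" by (auto simp: eventually_at_top_linorder)
  \<comment> \<open>By \<open>left_tail\<close>, at time \<open>t0\<close> the solution is at least
    \<open>q1\<close> to the left of \<open>- R\<close>, hence above the whole wave.\<close>
  define R where "R = max 0 (- (ln (1 - q1) + a - t0))"
  have R0: "R \<ge> 0" by (simp add: R_def)
  have far: "u x t0 \<ge> q1" if "x \<le> - R" for x
  proof -
    have "x - a + t0 \<le> ln (1 - q1)" using that by (auto simp: R_def)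
    then have "exp (x - a + t0) \<le> 1 - q1" using \<open>q1 < 1\<close> by (simp add: ln_ge_iff)
    then show ?thesis using left_tail[OF t0(1), of x] by simp
  qed
  \<comment> \<open>At time \<open>t0\<close> the shifted wave is already below
    \<open>l - \<delta>\<close> to the right of \<open>- R\<close>.\<close>
  define s where "s = \<xi>1 + R + cb * t0"
  \<comment> \<open>On the moving boundary \<open>x = c' * t\<close> the wave is already below \<open>l - \<delta> \<le> u\<close>, because \<open>c' > cb\<close>.\<close>
  define G where "G = {(x, t). t0 \<le> t \<and> x \<le> c' * t}"
  have G_closed: "closed G"
    unfolding G_def case_prod_unfold by (intro closed_Collect_conj closed_Collect_le continuous_intros)
  have le: "U (x - cb * t + s) \<le> u x t" if xt: "(x, t) \<in> G" for x t
  proof (rule sub_comparison[where w = "\<lambda>x t. U (x - cb * t + s)", OF G_closed _ t0(1) _ _ _ xt])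
    show "t0 \<le> t" if "(x, t) \<in> G" for x t using that by (simp add: G_def)
    show "continuous_on G (\<lambda>(x, t). U (x - cb * t + s))" by (rule continuous_on_wave[OF U(3)])
    show "U (x - cb * t + s) \<le> 1" for x t using U(2)[of "x - cb * t + s"] \<open>q1 < 1\<close> by simp
    fix x t assume xt: "(x, t) \<in> G" and less: "u x t < U (x - cb * t + s)"
    let ?q = "U (x - cb * t + s)"
    have t: "t0 \<le> t" and x: "x \<le> c' * t" using xt by (auto simp: G_def)
    have small: "x - cb * t + s < \<xi>1"
    proof (rule ccontr)
      assume "\<not> ?thesis"
      then have "?q < l - \<delta>" by (intro \<xi>1) simp
      then show False using T0[of t x] t t0 x less by auto
    qed
    have "x < c' * t"
    proof (rule ccontr)
      assume "\<not> x < c' * t"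
      then have "x = c' * t" using x by simp
      moreover have "cb * t \<le> c' * t" "0 \<le> cb * t0" using c' t t0 cb by (auto intro: mult_right_mono)
      ultimately show False using small R0 by (simp add: s_def)
    qed
    moreover have "t0 < t"
    proof (rule ccontr)
      assume "\<not> t0 < t"
      then have "t = t0" using t by simp
      then show False using far[of x] less U(2)[of "x - cb * t + s"] small by (cases "x \<le> - R") (auto simp: s_def)
    qed
    ultimately have "(x, t) \<in> {(x, t). t0 < t \<and> x < c' * t}" by simp
    moreover have "open {(x, t). t0 < t \<and> x < c' * t}"
      unfolding case_prod_unfold by (intro open_Collect_conj open_Collect_less continuous_intros)
    moreover have "{(x, t). t0 < t \<and> x < c' * t} \<subseteq> G" by (auto simp: G_def)
    ultimately have int: "(x, t) \<in> interior G" by (meson interiorI)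
    have "?q > 0" using less u_range(1)[of t x] t t0 by simp
    then obtain D' where D': "(v has_real_derivative D') (at ?q within {..?q})" "v ?q * D' - cb * v ?q + f ?q \<ge> 0"
      using D[OF U(1) _ U(2)] by blast
    from int parabolic_derivs_wave[where v = v, OF U(3) vU D'(1)]
    show "(x, t) \<in> interior G \<and> (\<exists>wt wxx. parabolic_derivs (\<lambda>x t. U (x - cb * t + s)) x t wt wxx \<and> wt \<le> wxx + f ?q)"
      using D'(2) by (intro conjI exI[of _ "cb * v ?q"] exI[of _ "v ?q * D'"]) auto
  qed
  have "eventually (\<lambda>\<xi>. q2 < U \<xi>) at_bot" using lim(2) \<open>q2 < q1\<close> by (rule order_tendstoD)
  then obtain N where N: "\<And>\<xi>. \<xi> \<le> N \<Longrightarrow> q2 < U \<xi>" by (auto simp: eventually_at_bot_linorder)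
  have "u x t \<ge> q2" if t: "t \<ge> t0" and x: "x \<le> cb * t - max 0 (s - N)" for x t
  proof -
    have "cb * t \<le> c' * t" using c' t t0 by (intro mult_right_mono) auto
    then have "(x, t) \<in> G" using t x by (auto simp: G_def)
    moreover have "x - cb * t + s \<le> N" using x by linarith
    ultimately show ?thesis using le[of x t] N[of "x - cb * t + s"] by linarith
  qed
  then show ?thesis using t0(1) by blast
qed

text \<open>Subsolution \<open>y t - E x t\<close>: \<open>y\<close> relaxes from \<open>q\<close>
  to \<open>R\<close>, and \<open>E\<close> is an exponential layer moving with speed
  \<open>cb\<close> which reaches \<open>1\<close> at \<open>x = cb * t - L\<close>. Where the
  subsolution exceeds \<open>u \<ge> 0\<close>, the layer is below \<open>1\<close>; there
  \<open>u \<ge> q\<close>, so the subsolution lies between \<open>q\<close> and \<open>R\<close>,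
  where \<open>f \<ge> m\<close>.\<close>

lemma lower_bootstrap:
  assumes t1: "t1 \<ge> 0" and start: "\<And>t x. t \<ge> t1 \<Longrightarrow> x \<le> cb * t - L \<Longrightarrow> u x t \<ge> q"
    and q: "0 < q" "q < R" "R \<le> 1" and "m > 0" "\<And>y. q \<le> y \<Longrightarrow> y \<le> R \<Longrightarrow> f y \<ge> m"
    and "cb > 0" "c < cb" "\<delta> > 0"
  shows "\<exists>t0. \<forall>t\<ge>t0. \<forall>x\<le>c * t. u x t \<ge> R - \<delta>"
proof -
  \<comment> \<open>The source \<open>m\<close> is split in halves:
    \<open>(R - q) * \<kappa> = m / 2\<close> pays for the rise of \<open>y\<close>, and
    \<open>\<mu> * cb + \<mu> * \<mu> \<le> m / 2\<close> pays for the layer.\<close>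
  define \<kappa> where "\<kappa> = m / (2 * (R - q))"
  have \<kappa>: "\<kappa> > 0" "(R - q) * \<kappa> = m / 2"
    using q(2) \<open>m > 0\<close> nonzero_mult_div_cancel_left[of "R - q" "m / 2"] by (simp_all add: \<kappa>_def)
  define \<mu> where "\<mu> = min 1 (m / (2 * (cb + 1)))"
  have \<mu>: "\<mu> > 0" "\<mu> \<le> 1" using \<open>m > 0\<close> \<open>cb > 0\<close> by (auto simp: \<mu>_def)
  have "\<mu> * (cb + 1) \<le> m / (2 * (cb + 1)) * (cb + 1)"
    using \<open>cb > 0\<close> by (intro mult_right_mono) (auto simp: \<mu>_def)
  also have "\<dots> = m / 2" using \<open>cb > 0\<close> by (simp add: divide_simps)
  finally have "\<mu> * cb + \<mu> \<le> m / 2" by (simp add: algebra_simps)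
  moreover have "\<mu> * \<mu> \<le> \<mu> * 1" using \<mu> by (intro mult_left_mono) auto
  ultimately have \<mu>m: "\<mu> * cb + \<mu> * \<mu> \<le> m / 2" by simp
  define y where "y t = R - (R - q) * exp (- \<kappa> * (t - t1))" for t
  define E where "E x t = exp (\<mu> * (x - cb * t + L))" for x t
  have y_le: "y t \<le> R" for t using q by (simp add: y_def)
  have Epos: "E x t > 0" for x t by (simp add: E_def)
  have le: "y t - E x t \<le> u x t" if "t \<ge> t1" for x t
  proof (rule sub_comparison[where G = "UNIV \<times> {t1..}" and w = "\<lambda>x t. y t - E x t" and ?t0.0 = t1])
    show "continuous_on (UNIV \<times> {t1..}) (\<lambda>(x, t). y t - E x t)"
      unfolding case_prod_unfold y_def E_def by (intro continuous_intros)
    show "y t - E x t \<le> 1" for x t using y_le[of t] Epos[of x t] q by linarith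
  next
    fix x t assume "(x, t) \<in> UNIV \<times> {t1..}" and less: "u x t < y t - E x t"
    then have t: "t \<ge> t1" by simp
    have u0: "u x t \<ge> 0" using u_range t t1 by auto
    have E1: "E x t < 1" using u0 less y_le[of t] q by linarith
    then have "\<mu> * (x - cb * t + L) < 0" by (simp add: E_def)
    then have "x \<le> cb * t - L" using \<mu> by (simp add: mult_less_0_iff)
    then have uq: "u x t \<ge> q" using start t by auto
    have "t \<noteq> t1" using uq less Epos[of x t] by (auto simp: y_def)
    then have t': "t > t1" using t by simp
    have fm: "f (y t - E x t) \<ge> m"
      using uq less y_le[of t] Epos[of x t] by (intro assms(7)) auto
    let ?yt = "(R - q) * \<kappa> * exp (- \<kappa> * (t - t1))"
    have "parabolic_derivs (\<lambda>x t. y t - E x t) x t (?yt + \<mu> * cb * E x t) (- (\<mu> * \<mu> * E x t))"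
      unfolding y_def E_def
      by (rule parabolic_derivsI[where zx = "\<lambda>x. - (\<mu> * exp (\<mu> * (x - cb * t + L)))"])
        (auto intro!: derivative_eq_intros simp: algebra_simps)
    moreover have "?yt + \<mu> * cb * E x t \<le> - (\<mu> * \<mu> * E x t) + f (y t - E x t)"
    proof -
      have "exp (- \<kappa> * (t - t1)) \<le> 1" using \<kappa> t by (simp add: mult_nonpos_nonneg)
      then have "?yt \<le> (R - q) * \<kappa> * 1" using \<kappa> \<open>m > 0\<close> by (intro mult_left_mono) auto
      moreover have "(\<mu> * cb + \<mu> * \<mu>) * E x t \<le> m / 2 * 1"
        using \<mu>m E1 Epos[of x t] \<open>m > 0\<close> \<mu> \<open>cb > 0\<close> by (intro mult_mono) auto
      ultimately show ?thesis using fm \<kappa>(2) by (simp add: algebra_simps)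
    qed
    ultimately show "(x, t) \<in> interior (UNIV \<times> {t1..}) \<and> (\<exists>wt wxx.
        parabolic_derivs (\<lambda>x t. y t - E x t) x t wt wxx \<and> wt \<le> wxx + f (y t - E x t))"
      using interior_halfplane[OF t'] by blast
  qed (use that t1 in \<open>auto intro: closed_Times\<close>)
  define A where "A = ln (\<delta> / 2)"
  have expA: "exp A = \<delta> / 2" using \<open>\<delta> > 0\<close> by (simp add: A_def)
  show ?thesis
  proof (intro exI[of _ "max t1 (max (t1 - A / \<kappa>) ((L - A / \<mu>) / (cb - c)))"] allI impI)
    fix t x assume "max t1 (max (t1 - A / \<kappa>) ((L - A / \<mu>) / (cb - c))) \<le> t" and x: "x \<le> c * t"
    then have t: "t1 \<le> t" "t1 - A / \<kappa> \<le> t" "(L - A / \<mu>) / (cb - c) \<le> t" by auto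
    have "- \<kappa> * (t - t1) \<le> A" using t(2) \<kappa>(1) by (simp add: field_simps)
    then have "exp (- \<kappa> * (t - t1)) \<le> \<delta> / 2" unfolding expA[symmetric] by simp
    then have "(R - q) * exp (- \<kappa> * (t - t1)) \<le> 1 * (\<delta> / 2)" using q by (intro mult_mono) auto
    then have "y t \<ge> R - \<delta> / 2" by (simp add: y_def)
    moreover have "E x t \<le> \<delta> / 2"
    proof -
      have "L - A / \<mu> \<le> (cb - c) * t" using t(3) \<open>c < cb\<close> by (simp add: pos_divide_le_eq mult.commute)
      then have "x - cb * t + L \<le> A / \<mu>" using x by (simp add: algebra_simps)
      then have "\<mu> * (x - cb * t + L) \<le> A" using \<mu> by (simp add: pos_le_divide_eq mult.commute)
      then show ?thesis unfolding expA[symmetric] E_def by simp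
    qed
    ultimately show "R - \<delta> \<le> u x t" using le[OF t(1), of x] by linarith
  qed
qed

end

section \<open>Propagation at the critical speeds\<close>

lemma C1_differentiable_lipschitz:
  fixes f :: "real \<Rightarrow> real"
  assumes "f C1_differentiable_on UNIV"
  shows "\<exists>K\<ge>0. \<forall>y\<in>{-M..M}. \<forall>z\<in>{-M..M}. \<bar>f y - f z\<bar> \<le> K * \<bar>y - z\<bar>"
proof -
  obtain D where D: "\<And>x. (f has_real_derivative D x) (at x)" "continuous_on UNIV D"
    using assms by (auto simp: C1_differentiable_on_def has_real_derivative_iff_has_vector_derivative)
  have "bounded (D ` {-M..M})"
    using D(2) by (intro compact_imp_bounded compact_continuous_image) (auto intro: continuous_on_subset)
  then obtain K where K: "K > 0" "\<And>x. x \<in> {-M..M} \<Longrightarrow> norm (D x) \<le> K"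
    unfolding bounded_pos by auto
  have "norm (f y - f z) \<le> K * norm (y - z)" if "y \<in> {-M..M}" "z \<in> {-M..M}" for y z
    by (rule field_differentiable_bound[of "{-M..M}" f D])
      (use that K D(1) in \<open>auto intro: has_field_derivative_at_within\<close>)
  then show ?thesis using K(1) by (intro exI[of _ K]) auto
qed

lemma first_nonpos:
  fixes g :: "real \<Rightarrow> real"
  assumes "a < b" and cont: "continuous_on {a..b} g" and "g a > 0" "g b \<le> 0"
  obtains s where "a < s" "s \<le> b" "g s = 0" "\<And>q. a \<le> q \<Longrightarrow> q < s \<Longrightarrow> g q > 0"
proof -
  have cont': "continuous_on {-b..-a} (\<lambda>q. g (- q))"
    by (rule continuous_on_compose2[OF cont]) (auto intro!: continuous_intros)
  obtain s where s: "- b \<le> s" "s < - a" "g (- s) = 0" "\<And>q. s < q \<Longrightarrow> q \<le> - a \<Longrightarrow> g (- q) > 0"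
    using last_nonpos[OF _ cont'] assms by auto
  show thesis
  proof (rule that[of "- s"])
    show "g q > 0" if "a \<le> q" "q < - s" for q using s(4)[of "- q"] that by simp
  qed (use s in auto)
qed

context front_problem
begin

text \<open>The assumption on \<open>c1\<close> ensures that the wave stays behind the region where
  \<open>u\<close> is known to be nearly above \<open>l\<close>, even though the wave itself starts
  below \<open>l\<close>. \<open>lower_front\<close> then brings \<open>u\<close> to some level
  above \<open>l\<close>, and \<open>lower_bootstrap\<close> lifts it to \<open>r\<close>.\<close>

lemma spreads_below_step:
  assumes "monostable f l r K" and l: "0 \<le> l" and r: "r \<le> 1"
    and spread: "spreads_below l c1" and c1: "critical_speed f l r \<le> c1"
  shows "spreads_below r (critical_speed f l r)"
  unfolding spreads_below_def
proof (intro allI impI)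
  interpret M: monostable f l r K by fact
  fix c \<delta> :: real assume c: "c < critical_speed f l r" and \<delta>: "\<delta> > 0"
  \<comment> \<open>A nonpositive \<open>c\<close> is replaced by \<open>0\<close>, since the line
    of slope \<open>cb\<close> prolonging the profile below \<open>l\<close> needs
    \<open>cb > 0\<close>. The speeds \<open>cb < cc\<close> lie strictly between \<open>c0\<close>
    and the critical speed.\<close>
  define c0 where "c0 = max c 0"
  define cb where "cb = (2 * c0 + critical_speed f l r) / 3"
  define cc where "cc = (c0 + 2 * critical_speed f l r) / 3"
  define \<kappa> where "\<kappa> = cc - cb"
  have "0 \<le> c0" "c \<le> c0" "c0 < critical_speed f l r" using c M.critical_speed_pos by (auto simp: c0_def)
  then have cs: "0 < cb" "c < cb" "cb < cc" "cc < critical_speed f l r" "cb < c1" "\<kappa> > 0"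
    using c1 by (auto simp: cb_def cc_def \<kappa>_def)
  have lr: "l < r" by (rule M.l_less_r)
  obtain e v where e: "e > 0" and v: "M.traj cc e v" and vr: "v r < \<kappa> * (r - l)"
    using M.subcritical_traj[of cc "\<kappa> * (r - l)"] cs lr by auto
  \<comment> \<open>\<open>g' = cb - f / v\<close>, hence \<open>g * g' - cb * g + f = f * (v - g) / v \<ge> 0\<close>.\<close>
  define g where "g q = v q - \<kappa> * (q - l)" for q
  have g_cont: "continuous_on {l..r} g" unfolding g_def by (intro continuous_intros M.trajD(1)[OF v])
  obtain q1 where q1: "l < q1" "q1 \<le> r" "g q1 = 0" and g_pos: "\<And>q. l \<le> q \<Longrightarrow> q < q1 \<Longrightarrow> g q > 0"
    using first_nonpos[OF lr g_cont] e vr M.trajD(2)[OF v] by (auto simp: g_def)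
  have q1r: "q1 < r" using q1 vr by (cases "q1 = r") (auto simp: g_def)
  have v_pos: "v q > 0" if q: "l \<le> q" "q \<le> q1" for q
  proof -
    have "\<kappa> * (q1 - l) > 0" using cs q1 by simp
    then have "v q1 > 0" using q1(3) by (simp add: g_def)
    then show ?thesis using M.trajD(6)[OF v _ _ q1(2)] q by auto
  qed
  have g_deriv: "(g has_real_derivative cb - f q / v q) (at q)" if q: "l < q" "q < q1" for q
    unfolding g_def using M.trajD(5)[OF v, of q] v_pos[of q] q q1r
    by (auto intro!: derivative_eq_intros simp: \<kappa>_def)
  \<comment> \<open>At the zero \<open>q1\<close> of \<open>g\<close> the trajectory itself is still
    at height \<open>\<kappa> * (q1 - l) > 0\<close>. So \<open>v\<close> has a positive minimum,
    \<open>f / v\<close> is bounded, and \<open>g\<close> vanishes at most linearly at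
    \<open>q1\<close>, as a global profile requires.\<close>
  have "continuous_on {l..q1} v" using q1 by (auto intro: continuous_on_subset[OF M.trajD(1)[OF v]])
  then obtain qm where qm: "qm \<in> {l..q1}" "\<And>q. q \<in> {l..q1} \<Longrightarrow> v qm \<le> v q"
    using continuous_attains_inf[of "{l..q1}" v] q1 by auto
  define A where "A = K * (r - l) / v qm"
  have vqm: "v qm > 0" using v_pos qm by auto
  then have A0: "A \<ge> 0" using M.K_nonneg lr by (simp add: A_def)
  have fv: "f q / v q \<le> A" if q: "l \<le> q" "q \<le> q1" for q
    unfolding A_def using M.f_abs_le[of q] M.f_nonneg[of q] qm(2)[of q] vqm q q1 by (intro frac_le) auto
  have g_le: "g q \<le> A * (q1 - q)" if q: "l \<le> q" "q \<le> q1" for q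
  proof -
    have "g q + A * q \<le> g q1 + A * q1"
    proof (rule DERIV_nonneg_imp_increasing_open[OF q(2), where f = "\<lambda>q. g q + A * q"])
      fix x assume x: "q < x" "x < q1"
      have "((\<lambda>q. g q + A * q) has_real_derivative cb - f x / v x + A) (at x)"
        using g_deriv[of x] x q by (auto intro!: derivative_eq_intros)
      moreover have "cb - f x / v x + A \<ge> 0" using fv[of x] x q cs by auto
      ultimately show "\<exists>y. ((\<lambda>q. g q + A * q) has_real_derivative y) (at x) \<and> 0 \<le> y" by blast
    qed (use q q1 in \<open>auto intro!: continuous_intros continuous_on_subset[OF g_cont]\<close>)
    then show ?thesis using q1(3) by (simp add: algebra_simps)
  qed
  \<comment> \<open>The zero of the line of slope \<open>cb\<close> through height \<open>e\<close>
    at \<open>l\<close>. For \<open>l = 0\<close> it is negative, and the part of the wave below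
    \<open>0\<close> needs no check because \<open>u \<ge> 0\<close>.\<close>
  define \<alpha> where "\<alpha> = l - e / cb"
  have \<alpha>: "\<alpha> < l" using e cs by (simp add: \<alpha>_def)
  have line: "e + cb * (q - l) = cb * (q - \<alpha>)" for q using cs by (simp add: \<alpha>_def algebra_simps)
  \<comment> \<open>A slope \<open>\<ge> cb\<close> is a subsolution wherever \<open>f \<ge> 0\<close>, so the profile may start below \<open>l\<close>.\<close>
  define h where "h q = (if q \<le> l then e + cb * (q - l) else g q)" for q
  have gl: "g l = e" using M.trajD(2)[OF v] by (simp add: g_def)
  define q2 where "q2 = (l + q1) / 2"
  have q2: "l < q2" "q2 < q1" using q1 by (auto simp: q2_def)
  have "\<exists>t0\<ge>0. \<exists>L. \<forall>t\<ge>t0. \<forall>x\<le>cb * t - L. u x t \<ge> q2"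
  proof (rule lower_front[OF spread _ cs(1,5) \<alpha> q1(1), where v = h and C = "max cb A"])
    show "q1 < 1" using q1r r by simp
    show "continuous_on {\<alpha><..<q1} h"
      unfolding h_def
    proof (rule continuous_on_cases_le)
      show "continuous_on {x \<in> {\<alpha><..<q1}. l \<le> x} g"
        by (rule continuous_on_subset[OF g_cont]) (use q1 in auto)
    qed (auto intro!: continuous_intros simp: gl)
    fix q assume q: "\<alpha> < q" "q < q1"
    show "h q > 0"
    proof (cases "q \<le> l")
      case True
      have "cb * (q - \<alpha>) > 0" using q cs by simp
      then show ?thesis using True line[of q] by (simp add: h_def)
    qed (use g_pos q in \<open>auto simp: h_def\<close>)
    have "h q \<le> cb * (q - \<alpha>)"
    proof (cases "q \<le> l")
      case False
      then have "v q \<le> e + cc * (q - l)"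
        using M.traj_growth[OF v, of l q] M.trajD(2)[OF v] q q1 cs by auto
      then show ?thesis using False line[of q] by (simp add: h_def g_def \<kappa>_def algebra_simps)
    qed (simp add: h_def line)
    also have "\<dots> \<le> max cb A * (q - \<alpha>)" using q by (intro mult_right_mono) auto
    finally show "h q \<le> max cb A * (q - \<alpha>)" .
    have "h q \<le> A * (q1 - q)"
    proof (cases "q \<le> l")
      case True
      then have "cb * (q - l) \<le> 0" using cs by (simp add: mult_nonneg_nonpos)
      then have "h q \<le> g l" using True gl by (simp add: h_def)
      also have "\<dots> \<le> A * (q1 - l)" using g_le[of l] q1 by simp
      also have "\<dots> \<le> A * (q1 - q)" using True A0 by (intro mult_left_mono) auto
      finally show ?thesis .
    qed (use g_le[of q] q in \<open>auto simp: h_def\<close>)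
    also have "\<dots> \<le> max cb A * (q1 - q)" using q by (intro mult_right_mono) auto
    finally show "h q \<le> max cb A * (q1 - q)" .
  next
    fix q assume q: "\<alpha> < q" "0 < q" "q < q1"
    have fq: "f q \<ge> 0" using q q1 r by (intro f_nonneg) auto
    show "\<exists>D. (h has_real_derivative D) (at q within {..q}) \<and> h q * D - cb * h q + f q \<ge> 0"
    proof (cases "q \<le> l")
      case True
      have "((\<lambda>q. e + cb * (q - l)) has_real_derivative cb) (at q within {..q})"
        by (auto intro!: derivative_eq_intros)
      then have "(h has_real_derivative cb) (at q within {..q})"
        by (rule has_field_derivative_transform_within[where d = 1]) (use True in \<open>auto simp: h_def\<close>)
      then show ?thesis using fq by (intro exI[of _ cb]) auto
    next
      case False
      have "(g has_real_derivative cb - f q / v q) (at q within {..q})"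
        using g_deriv[of q] False q by (auto intro: has_field_derivative_at_within)
      then have "(h has_real_derivative cb - f q / v q) (at q within {..q})"
        by (rule has_field_derivative_transform_within[where d = "q - l"])
          (use False in \<open>auto simp: h_def dist_real_def\<close>)
      moreover have "h q * (cb - f q / v q) - cb * h q + f q = f q * (v q - g q) / v q"
        using False v_pos[of q] q by (simp add: h_def field_simps)
      moreover have "f q * (v q - g q) / v q \<ge> 0"
        using False v_pos[of q] q fq cs by (simp add: g_def)
      ultimately show ?thesis by (intro exI[of _ "cb - f q / v q"]) auto
    qed
  qed (rule q2(2))
  then obtain t1 L where t1: "t1 \<ge> 0" "\<And>t x. t \<ge> t1 \<Longrightarrow> x \<le> cb * t - L \<Longrightarrow> u x t \<ge> q2" by blast
  \<comment> \<open>Within \<open>\<delta> / 2\<close> of \<open>r\<close> and above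
    \<open>q2\<close>, yet strictly below \<open>r\<close>, so that \<open>f\<close> has a positive
    minimum on \<open>{q2..R}\<close>.\<close>
  define R where "R = max (r - \<delta> / 2) ((q1 + r) / 2)"
  have R: "q2 < R" "R < r" "r - \<delta> / 2 \<le> R" using q2 q1r \<delta> by (auto simp: R_def less_max_iff_disj)
  obtain m where m: "m > 0" "\<And>y. q2 \<le> y \<Longrightarrow> y \<le> R \<Longrightarrow> f y \<ge> m"
    using M.f_min[of q2 R] q2 R by auto
  have "\<exists>t0. \<forall>t\<ge>t0. \<forall>x\<le>c * t. u x t \<ge> R - \<delta> / 2"
    by (rule lower_bootstrap[OF t1]) (use q2 R l r m cs \<delta> in auto)
  then obtain t0 where "\<And>t x. t \<ge> t0 \<Longrightarrow> x \<le> c * t \<Longrightarrow> u x t \<ge> R - \<delta> / 2" by blast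
  then show "\<exists>t0. \<forall>t\<ge>t0. \<forall>x\<le>c * t. u x t \<ge> r - \<delta>"
    using R(3) by (intro exI[of _ t0]) (force intro: order_trans[rotated])
qed

lemma spreads_below_zero: "spreads_below 0 c"
  unfolding spreads_below_def
proof (intro allI impI)
  fix c \<delta> :: real assume "\<delta> > 0"
  then show "\<exists>t0. \<forall>t\<ge>t0. \<forall>x\<le>c * t. u x t \<ge> 0 - \<delta>"
    using order_trans[OF _ u_range(1), of "0 - \<delta>"] by (intro exI[of _ 0]) auto
qed

text \<open>A trajectory with \<open>e > 0\<close> does not vanish at \<open>l\<close>, so its
  profile would reach \<open>l\<close> at a finite point. The limiting trajectory has the linear
  bound at \<open>l\<close>; its wave solves the equation exactly and tends to
  \<open>l\<close>.\<close>

lemma upper_front_top: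
  assumes "monostable f l 1 K" "0 \<le> l" "critical_speed f l 1 < c" "\<delta> > 0"
  shows "\<exists>t0. \<forall>t\<ge>t0. \<forall>x\<ge>c * t. u x t \<le> l + \<delta>"
proof -
  interpret M: monostable f l 1 K by fact
  obtain c' where c': "c' \<in> M.speeds" "c' < c" using M.speeds_below assms(3) by blast
  note lim = M.limit_traj[OF c'(1)]
  show ?thesis
  proof (rule upper_front[where v = "M.traj_limit c'" and C = c' and c = c'])
    show "continuous_on {l<..1} (M.traj_limit c')"
      unfolding continuous_on_eq_continuous_within
      by (auto intro!: DERIV_continuous[OF has_field_derivative_subset[OF lim(3)]])
    fix q assume q: "l < q" "q < 1"
    have "(M.traj_limit c' has_real_derivative c' - f q / M.traj_limit c' q) (at q within {..q})"
      by (rule has_field_derivative_subset[OF lim(3)]) (use q in auto)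
    moreover have "M.traj_limit c' q * (c' - f q / M.traj_limit c' q) - c' * M.traj_limit c' q + f q = 0"
      using lim(1)[of q] q by (simp add: field_simps)
    ultimately show "\<exists>D. (M.traj_limit c' has_real_derivative D) (at q within {..q}) \<and>
        M.traj_limit c' q * D - c' * M.traj_limit c' q + f q \<le> 0"
      by (intro exI[of _ "c' - f q / M.traj_limit c' q"]) simp
  qed (use assms M.l_less_r c' lim in auto)
qed

text \<open>The limiting trajectory of the lower step arrives at \<open>l\<close> with a height
  \<open>e > 0\<close>. For an admissible speed of the upper step every positive starting height
  survives up to \<open>1\<close>, so the two pieces can be joined continuously at
  \<open>l\<close>.\<close>

lemma upper_front_two:
  assumes "monostable f 0 l K" "monostable f l 1 K'"
    and "critical_speed f 0 l < c" "critical_speed f l 1 < c" "\<delta> > 0"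
  shows "\<exists>t0. \<forall>t\<ge>t0. \<forall>x\<ge>c * t. u x t \<le> 0 + \<delta>"
proof -
  interpret M: monostable f 0 l K by fact
  interpret N: monostable f l 1 K' by fact
  obtain c1 where c1: "c1 \<in> M.speeds" "c1 < c" using M.speeds_below assms(3) by blast
  obtain c2 where c2: "c2 \<in> N.speeds" "c2 < c" using N.speeds_below assms(4) by blast
  have pos: "c1 > 0" "c2 > 0" using c1 c2 by (auto simp: M.speeds_def N.speeds_def)
  have l: "0 < l" "l < 1" using M.l_less_r N.l_less_r by auto
  note lim = M.limit_traj[OF c1(1)]
  define e where "e = M.traj_limit c1 l"
  have e: "e > 0" "e \<le> c1 * l" using lim(1,2)[of l] l by (auto simp: e_def)
  obtain w where w: "N.traj c2 e w" "\<And>q. q \<in> {l..1} \<Longrightarrow> w q > 0"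
    using N.supercritical_traj[OF c2(1) e(1)] by blast
  define v where "v q = (if q \<le> l then M.traj_limit c1 q else w q)" for q
  \<comment> \<open>Each piece is exact for its own speed, so at speed \<open>cm\<close> the residue
    is \<open>(c1 - cm) * v\<close> or \<open>(c2 - cm) * v\<close>, never positive. At the joint
    the left derivative is that of the lower piece.\<close>
  define cm where "cm = max c1 c2"
  show ?thesis
  proof (rule upper_front[where v = v and C = "c1 + c2" and c = cm])
    show "continuous_on {0<..1} v"
      unfolding v_def
    proof (rule continuous_on_cases_le)
      show "continuous_on {x \<in> {0<..1}. x \<le> l} (M.traj_limit c1)"
        unfolding continuous_on_eq_continuous_within
        by (auto intro!: DERIV_continuous[OF has_field_derivative_subset[OF lim(3)]])
      show "continuous_on {x \<in> {0<..1}. l \<le> x} w"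
        by (rule continuous_on_subset[OF N.trajD(1)[OF w(1)]]) auto
    qed (use N.trajD(2)[OF w(1)] in \<open>auto simp: e_def intro!: continuous_intros\<close>)
  next
    fix q :: real assume q: "0 < q" "q \<le> 1"
    show "v q > 0" using lim(1)[of q] w(2)[of q] q by (auto simp: v_def)
    show "v q \<le> (c1 + c2) * (q - 0)"
    proof (cases "q \<le> l")
      case True
      then have "v q \<le> c1 * q" using lim(2)[of q] q by (simp add: v_def)
      also have "\<dots> \<le> (c1 + c2) * q" using q pos by (intro mult_right_mono) auto
      finally show ?thesis by simp
    next
      case False
      have "v q \<le> e + c2 * (q - l)"
        using N.traj_growth[OF w(1), of l q] N.trajD(2)[OF w(1)] False q pos by (simp add: v_def)
      also have "\<dots> \<le> c1 * q + c2 * q"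
      proof (rule add_mono)
        show "e \<le> c1 * q" using e(2) mult_left_mono[of l q c1] False pos by linarith
        show "c2 * (q - l) \<le> c2 * q" using l pos by (intro mult_left_mono) auto
      qed
      finally show ?thesis by (simp add: distrib_right)
    qed
  next
    fix q :: real assume q: "0 < q" "q < 1"
    show "\<exists>D. (v has_real_derivative D) (at q within {..q}) \<and> v q * D - cm * v q + f q \<le> 0"
    proof (cases "q \<le> l")
      case True
      have "(M.traj_limit c1 has_real_derivative c1 - f q / M.traj_limit c1 q) (at q within {..q})"
        by (rule has_field_derivative_subset[OF lim(3)]) (use q True in auto)
      then have "(v has_real_derivative c1 - f q / v q) (at q within {..q})"
        using True by (auto simp: v_def intro: has_field_derivative_transform_within[where d = 1])
      moreover have vq: "v q > 0" using lim(1)[of q] q True by (simp add: v_def)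
      then have "v q * (c1 - f q / v q) - cm * v q + f q = (c1 - cm) * v q"
        by (simp add: field_simps)
      moreover have "(c1 - cm) * v q \<le> 0" using vq by (intro mult_nonpos_nonneg) (auto simp: cm_def)
      ultimately show ?thesis by (intro exI[of _ "c1 - f q / v q"]) auto
    next
      case False
      have "(w has_real_derivative c2 - f q / w q) (at q within {..q})"
        using N.trajD(5)[OF w(1), of q] w(2)[of q] False q by (auto intro: has_field_derivative_at_within)
      then have "(v has_real_derivative c2 - f q / w q) (at q within {..q})"
        by (rule has_field_derivative_transform_within[where d = "q - l"])
          (use False in \<open>auto simp: v_def dist_real_def\<close>)
      then have "(v has_real_derivative c2 - f q / v q) (at q within {..q})" using False by (simp add: v_def)
      moreover have vq: "v q > 0" using w(2)[of q] q False by (simp add: v_def)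
      then have "v q * (c2 - f q / v q) - cm * v q + f q = (c2 - cm) * v q"
        by (simp add: field_simps)
      moreover have "(c2 - cm) * v q \<le> 0" using vq by (intro mult_nonpos_nonneg) (auto simp: cm_def)
      ultimately show ?thesis by (intro exI[of _ "c2 - f q / v q"]) auto
    qed
  qed (use c1 c2 \<open>\<delta> > 0\<close> in \<open>auto simp: cm_def\<close>)
qed

section \<open>Limits seen by an observer moving with constant speed\<close>

lemma spreads_below_eventually:
  assumes "spreads_below l c1" "c < c1" "\<delta> > 0"
  shows "\<forall>\<^sub>F t in at_top. u (x + c * t) t \<ge> l - \<delta>"
proof -
  define c2 where "c2 = (c + c1) / 2"
  have c2: "c < c2" "c2 < c1" using assms(2) by (auto simp: c2_def)
  obtain t0 where t0: "\<And>t x. t \<ge> t0 \<Longrightarrow> x \<le> c2 * t \<Longrightarrow> u x t \<ge> l - \<delta>"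
    using assms c2 unfolding spreads_below_def by blast
  show ?thesis
    using eventually_ge_at_top[of "max t0 (x / (c2 - c))"]
  proof eventually_elim
    case (elim t)
    then have "x / (c2 - c) \<le> t" by simp
    then have "x \<le> t * (c2 - c)" using c2 by (simp add: pos_divide_le_eq)
    then have "x + c * t \<le> c2 * t" by (simp add: algebra_simps)
    then show ?case using t0 elim by simp
  qed
qed

lemma upper_eventually:
  assumes up: "\<And>c \<delta>. c1 < c \<Longrightarrow> \<delta> > 0 \<Longrightarrow> \<exists>t0. \<forall>t\<ge>t0. \<forall>x\<ge>c * t. u x t \<le> l + \<delta>"
    and "c1 < c" "\<delta> > 0"
  shows "\<forall>\<^sub>F t in at_top. u (x + c * t) t \<le> l + \<delta>"
proof -
  define c2 where "c2 = (c + c1) / 2"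
  have c2: "c1 < c2" "c2 < c" using assms(2) by (auto simp: c2_def)
  obtain t0 where t0: "\<And>t x. t \<ge> t0 \<Longrightarrow> x \<ge> c2 * t \<Longrightarrow> u x t \<le> l + \<delta>"
    using up[OF c2(1) assms(3)] by blast
  show ?thesis
    using eventually_ge_at_top[of "max t0 (- x / (c - c2))"]
  proof eventually_elim
    case (elim t)
    then have "- x / (c - c2) \<le> t" by simp
    then have "- x \<le> t * (c - c2)" using c2 pos_divide_le_eq[of "c - c2" "- x" t] by simp
    then have "x + c * t \<ge> c2 * t" by (simp add: algebra_simps)
    then show ?case using t0 elim by simp
  qed
qed

lemma tendsto_between:
  assumes "\<And>\<delta>. \<delta> > 0 \<Longrightarrow> \<forall>\<^sub>F t in at_top. u (x + c * t) t \<ge> l - \<delta>"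
    and "\<And>\<delta>. \<delta> > 0 \<Longrightarrow> \<forall>\<^sub>F t in at_top. u (x + c * t) t \<le> l + \<delta>"
  shows "((\<lambda>t. u (x + c * t) t) \<longlongrightarrow> l) at_top"
proof (rule order_tendstoI)
  fix y assume "y < l"
  then show "\<forall>\<^sub>F t in at_top. y < u (x + c * t) t"
    using assms(1)[of "(l - y) / 2"] by (auto elim!: eventually_mono simp: field_simps)
next
  fix y assume "l < y"
  then show "\<forall>\<^sub>F t in at_top. u (x + c * t) t < y"
    using assms(2)[of "(y - l) / 2"] by (auto elim!: eventually_mono simp: field_simps)
qed

end

theorem proposition3p1:
  fixes f u0 :: "real \<Rightarrow> real" and u :: "real \<Rightarrow> real \<Rightarrow> real"
    and S1 S2 S3 c12 c23 a b x c :: real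
  assumes "S1 = 0" and "S2 = 1 / 2" and "S3 = 1"
    and "f C1_differentiable_on UNIV"
    and "\<forall>v\<in>{0..1}. f v \<ge> 0"
    and "{v \<in> {0..1}. f v = 0} = {S1, S2, S3}"
    and "c12 = critical_speed f S1 S2"
    and "c23 = critical_speed f S2 S3"
    and "c12 > c23"
    and "\<forall>y. u0 y \<in> {S1..S3}"
    and "a < b"
    and "\<forall>y\<le>a. u0 y = S3"
    and "\<forall>y\<ge>b. u0 y = S1"
    and "is_solution f u0 u"
    and "c \<noteq> c12" and "c \<noteq> c23"
  shows "((\<lambda>t. u (x + c * t) t) \<longlongrightarrow>
            (if c < c23 then S3 else if c < c12 then S2 else S1)) at_top"
proof -
  have zeros: "f v = 0 \<longleftrightarrow> v = 0 \<or> v = 1 / 2 \<or> v = 1" if "0 \<le> v" "v \<le> 1" for v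
  proof -
    have "v \<in> {v \<in> {0..1}. f v = 0} \<longleftrightarrow> v \<in> {S1, S2, S3}" by (simp only: assms(6))
    then show ?thesis using that by (simp add: assms(1-3))
  qed
  have ends: "f 0 = 0" "f (1 / 2) = 0" "f 1 = 0" using zeros by auto
  obtain K where K: "\<And>y z. y \<in> {-1..1} \<Longrightarrow> z \<in> {-1..1} \<Longrightarrow> \<bar>f y - f z\<bar> \<le> K * \<bar>y - z\<bar>"
    using C1_differentiable_lipschitz[OF assms(4), of 1] by blast
  have cont: "continuous_on A f" for A
    using assms(4) by (auto intro: C1_differentiable_imp_continuous_on C1_differentiable_on_subset)
  have mono: "monostable f l r K"
    if lr: "0 \<le> l" "l < r" "r \<le> 1" "f l = 0" "f r = 0"
      "\<And>q. l < q \<Longrightarrow> q < r \<Longrightarrow> q \<noteq> 1 / 2" for l r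
  proof
    show "f q > 0" if q: "l < q" "q < r" for q
    proof -
      have "q \<in> {0..1}" "0 < q" "q < 1" "q \<noteq> 1 / 2" using q lr(1,3) lr(6)[of q] by auto
      moreover from this have "f q \<ge> 0" "f q \<noteq> 0" using assms(5) zeros[of q] by auto
      ultimately show ?thesis by simp
    qed
    show "f q \<le> K * (q - l)" if "l \<le> q" "q \<le> r" for q
      using K[of q l] that lr(1-4) by auto
  qed (use lr cont in auto)
  have M: "monostable f 0 (1 / 2) K" and N: "monostable f (1 / 2) 1 K"
    using ends by (auto intro!: mono)
  interpret front_problem f u0 u a b
  proof
    show "\<exists>K\<ge>0. \<forall>y\<in>{-M..M}. \<forall>z\<in>{-M..M}. \<bar>f y - f z\<bar> \<le> K * \<bar>y - z\<bar>" for M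
      by (rule C1_differentiable_lipschitz[OF assms(4)])
  qed (use assms ends in auto)
  have c12: "c12 = critical_speed f 0 (1 / 2)" and c23: "c23 = critical_speed f (1 / 2) 1"
    by (simp_all only: assms(1-3,7,8))
  have low12: "spreads_below (1 / 2) c12"
    unfolding c12 by (rule spreads_below_step[OF M _ _ spreads_below_zero order_refl]) auto
  \<comment> \<open>Here \<open>c12 > c23\<close> enters: the bound by \<open>1 / 2\<close> has
    spread ahead of the region in which the upper wave is compared.\<close>
  have low23: "spreads_below 1 c23"
    unfolding c23 by (rule spreads_below_step[OF N _ _ low12]) (use assms(9) c23 in auto)
  have up23: "\<exists>t0. \<forall>t\<ge>t0. \<forall>x\<ge>c * t. u x t \<le> 1 / 2 + \<delta>" if "c23 < c" "\<delta> > 0" for c \<delta>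
    using upper_front_top[OF N, of c \<delta>] that c23 by auto
  \<comment> \<open>One supersolution has to cover all values from \<open>0\<close> to
    \<open>1\<close>, so its speed must exceed both critical speeds; \<open>c > c12 > c23\<close>
    provides this.\<close>
  have up12: "\<exists>t0. \<forall>t\<ge>t0. \<forall>x\<ge>c * t. u x t \<le> 0 + \<delta>" if "c12 < c" "\<delta> > 0" for c \<delta>
    using upper_front_two[OF M N, of c \<delta>] that c12 c23 assms(9) by auto
  consider "c < c23" | "c23 < c" "c < c12" | "c12 < c" using assms(15,16) by linarith
  then show ?thesis
  proof cases
    case 1
    have "((\<lambda>t. u (x + c * t) t) \<longlongrightarrow> 1) at_top"
    proof (rule tendsto_between)
      show "\<forall>\<^sub>F t in at_top. u (x + c * t) t \<le> 1 + \<delta>" if "\<delta> > 0" for \<delta>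
        using eventually_ge_at_top[of 0]
      proof eventually_elim
        case (elim t)
        then show ?case using u_range(2)[of t "x + c * t"] that by linarith
      qed
    qed (rule spreads_below_eventually[OF low23 1])
    then show ?thesis using 1 by (simp add: assms(3))
  next
    case 2
    have "((\<lambda>t. u (x + c * t) t) \<longlongrightarrow> 1 / 2) at_top"
      by (rule tendsto_between[OF spreads_below_eventually[OF low12 2(2)] upper_eventually[OF up23 2(1)]])
    then show ?thesis using 2 by (simp add: assms(2))
  next
    case 3
    have "((\<lambda>t. u (x + c * t) t) \<longlongrightarrow> 0) at_top"
    proof (rule tendsto_between)
      show "\<forall>\<^sub>F t in at_top. u (x + c * t) t \<ge> 0 - \<delta>" if "\<delta> > 0" for \<delta>
        by (rule spreads_below_eventually[OF spreads_below_zero _ that, of c "c + 1"]) simp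
    qed (rule upper_eventually[OF up12 3])
    then show ?thesis using 3 assms(9) by (simp add: assms(1))
  qed
qed

end
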